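(* There is a constant $c_n$ depending only on the dimension $n$ such that, for all weights $u\in A_1$ and $v\in A_1$ on $\mathbb{R}^n$ and every $f\in L^1(uv)$, $$\Big\|\frac{M(fv)}{v}\Big\|_{L^{1,\infty}(uv)}\le c_n\,[u]_{A_1}[v]_{A_\infty}\big([u]_{A_1}[v]_{A_\infty}+\log[v]_{A_1}\big)\|f\|_{L^1(uv)}.$$
   Context: A weight is a non-negative locally integrable function on $\mathbb{R}^n$, positive a.e. $Mf(x)=\sup_{Q\ni x}\frac1{|Q|}\int_Q|f|$ is the Hardy--Littlewood maximal operator, the supremum over cubes $Q$ with sides parallel to the axes. $u\in A_1$ means $[u]_{A_1}=\operatorname{ess\,sup}_x Mu(x)/u(x)<\infty$. The $A_\infty$ constant is the Fujii--Wilson constant $[w]_{A_\infty}=\sup_Q \frac{1}{w(Q)}\int_Q M(w\chi_Q)\,dx$. The product $uv$ need not be locally integrable; $uv$ also denotes the measure $u(x)v(x)\,dx$, $\|f\|_{L^1(uv)}=\int_{\mathbb{R}^n}|f|uv\,dx$ and $\|h\|_{L^{1,\infty}(uv)}=\sup_{t>0}t\,(uv)(\{x:|h(x)|>t\})$. *)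

theory Defs
  imports "HOL-Analysis.Analysis" "HOL-Probability.Essential_Supremum"
begin

text \<open>
  All measurability is with respect to the Lebesgue sigma-algebra (the completion of the Borel
  one), and averages, norms and weight constants are \<open>ennreal\<close>-valued, so that they are
  meaningful without any a priori finiteness assumption.
\<close>

definition cubes :: "(real ^ 'n) set set" where
  "cubes = {cbox a (a + (\<chi> i. l)) | a l. 0 < l}"

definition maximal :: "(real ^ 'n \<Rightarrow> real) \<Rightarrow> real ^ 'n \<Rightarrow> ennreal" where
  "maximal f x =
     (SUP Q\<in>{Q \<in> cubes. x \<in> Q}.
        (\<integral>\<^sup>+y\<in>Q. ennreal \<bar>f y\<bar> \<partial>lebesgue) / emeasure lebesgue Q)"

definition weight :: "(real ^ 'n \<Rightarrow> real) \<Rightarrow> bool" where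
  "weight w \<longleftrightarrow>
     w \<in> borel_measurable lebesgue \<and> (\<forall>x. 0 \<le> w x) \<and> (AE x in lebesgue. 0 < w x) \<and>
     (\<forall>K. compact K \<longrightarrow> set_integrable lebesgue K w)"

definition A1_const :: "(real ^ 'n \<Rightarrow> real) \<Rightarrow> ennreal" where
  "A1_const w = esssup lebesgue (\<lambda>x. maximal w x / ennreal (w x))"

definition A1_weight :: "(real ^ 'n \<Rightarrow> real) \<Rightarrow> bool" where
  "A1_weight w \<longleftrightarrow> weight w \<and> A1_const w < \<infinity>"

text \<open>The Fujii--Wilson constant.\<close>

definition Ainf_const :: "(real ^ 'n \<Rightarrow> real) \<Rightarrow> ennreal" where
  "Ainf_const w =
     (SUP Q\<in>cubes.
        (\<integral>\<^sup>+x\<in>Q. maximal (\<lambda>y. w y * indicator Q y) x \<partial>lebesgue) /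
        (\<integral>\<^sup>+x\<in>Q. ennreal (w x) \<partial>lebesgue))"

text \<open>The measure \<open>w(x) dx\<close>; the density need not be locally integrable.\<close>

definition weighted :: "(real ^ 'n \<Rightarrow> real) \<Rightarrow> (real ^ 'n) measure" where
  "weighted w = density lebesgue (\<lambda>x. ennreal (w x))"

definition L1_norm :: "'a measure \<Rightarrow> ('a \<Rightarrow> real) \<Rightarrow> ennreal" where
  "L1_norm M f = (\<integral>\<^sup>+x. ennreal \<bar>f x\<bar> \<partial>M)"

text \<open>
  The weak norm of a nonnegative extended-real-valued \<open>h\<close>. It is meant for measurable \<open>h\<close>, since
  \<open>emeasure\<close> vanishes on nonmeasurable sets.
\<close>

definition weak_L1_norm :: "'a measure \<Rightarrow> ('a \<Rightarrow> ennreal) \<Rightarrow> ennreal" where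
  "weak_L1_norm M h = (SUP t\<in>{0::real<..}. ennreal t * emeasure M {x \<in> space M. ennreal t < h x})"

end

theory Submission
  imports Defs
begin

text \<open>
  Put \<open>h = 4^n |f| v / t\<close>. If \<open>M(fv)(x) > t v(x)\<close> and \<open>2^k \<le> v(x) < 2^(k+1)\<close>, then \<open>x\<close> lies in
  the triple \<open>T\<close> of a dyadic cube \<open>Q\<close> on which \<open>h\<close> has average more than \<open>2^k\<close>. Finitely many
  pairs \<open>(k, Q)\<close> suffice, and for each \<open>k\<close> only the maximal, hence disjoint, cubes are kept. They
  are sorted by the integer \<open>l\<close> for which the average of \<open>v\<close> over \<open>T\<close> is about \<open>2^(k+l)\<close>.

  For fixed \<open>l\<close> the sum of \<open>2^k u(T)\<close> is at most a dimensional multiple of \<open>[u] [v]\<close> times the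
  integral of \<open>h u\<close>, with the \<open>A\<^sub>1\<close> constant of \<open>u\<close> and the Fujii--Wilson constant of \<open>v\<close>. Below a
  given cube the numbers \<open>2^k\<close> at a point grow geometrically and are dominated by the localised
  maximal function of \<open>v\<close>; a selection of principal cubes for the averages of \<open>u\<close> then reduces
  everything to \<open>Mu \<le> [u] u\<close>.

  The part of \<open>T\<close> where \<open>v\<close> is about \<open>2^k\<close> is null when \<open>2^(l-1) > [v]\<close>, by the \<open>A\<^sub>1\<close>
  condition on \<open>v\<close>, and for negative \<open>l\<close> it carries a share of \<open>u(T)\<close> that decays geometrically in
  \<open>-l\<close> with ratio \<open>1 - 1 / (2 [u])\<close> per \<open>n + 1\<close> steps. Summation over \<open>l\<close> gives the second
  factor, the logarithm counting the nonnegative values of \<open>l\<close>.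
\<close>

section \<open>Dyadic cubes and their triples\<close>

definition halfopen :: "real ^ 'n \<Rightarrow> real \<Rightarrow> (real ^ 'n) set" where
  "halfopen a l = {x. \<forall>i. a $ i \<le> x $ i \<and> x $ i < a $ i + l}"

lemma cbox_sidelength: "cbox a (a + (\<chi> i. l)) = {x::real^'n. \<forall>i. a $ i \<le> x $ i \<and> x $ i \<le> a $ i + l}"
  by (auto simp: mem_box_cart)

lemma emeasure_cube:
  fixes a :: "real ^ 'n"
  assumes "0 \<le> l"
  shows "emeasure lebesgue (cbox a (a + (\<chi> i. l))) = ennreal (l ^ CARD('n))"
    and "emeasure lebesgue (box a (a + (\<chi> i. l))) = ennreal (l ^ CARD('n))"
proof -
  have ne: "cbox a (a + (\<chi> i. l)) \<noteq> {}"
    using assms by (auto simp: cbox_sidelength intro!: exI[of _ a])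
  have "measure lborel (cbox a (a + (\<chi> i. l))) = l ^ CARD('n)"
    using content_cbox_cart[OF ne] by simp
  then show 1: "emeasure lebesgue (cbox a (a + (\<chi> i. l))) = ennreal (l ^ CARD('n))"
    using emeasure_eq_ennreal_measure[of lborel "cbox a (a + (\<chi> i. l))"] emeasure_lborel_cbox_finite[of a "a + (\<chi> i. l)"]
    by (simp add: less_top)
  show "emeasure lebesgue (box a (a + (\<chi> i. l))) = ennreal (l ^ CARD('n))"
    using 1 by (simp add: emeasure_lborel_box_eq emeasure_lborel_cbox_eq)
qed

lemma halfopen_subset:
  "box a (a + (\<chi> i. l)) \<subseteq> halfopen a l" "halfopen a l \<subseteq> cbox a (a + (\<chi> i. l))"
  by (auto simp: halfopen_def mem_box_cart less_imp_le)

lemma halfopen_borel [measurable]: "halfopen a l \<in> sets borel"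
  unfolding halfopen_def by measurable

lemma halfopen_lebesgue [measurable]: "halfopen a l \<in> sets lebesgue"
  using halfopen_borel[of a l] by (simp add: sets_completionI_sets)

lemma emeasure_halfopen:
  fixes a :: "real ^ 'n"
  assumes "0 \<le> l"
  shows "emeasure lebesgue (halfopen a l) = ennreal (l ^ CARD('n))"
    and "emeasure lborel (halfopen a l) = ennreal (l ^ CARD('n))"
proof -
  show "emeasure lebesgue (halfopen a l) = ennreal (l ^ CARD('n))"
    using emeasure_mono[OF halfopen_subset(2)[of a l], of lebesgue]
      emeasure_mono[OF halfopen_subset(1)[of a l], of lebesgue] emeasure_cube[OF assms, of a]
    by (intro antisym) simp_all
  then show "emeasure lborel (halfopen a l) = ennreal (l ^ CARD('n))" by simp
qed

lemma AE_halfopen_cbox: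
  fixes a :: "real ^ 'n"
  assumes "0 \<le> l"
  shows "AE x in lebesgue. x \<in> cbox a (a + (\<chi> i. l)) \<longleftrightarrow> x \<in> halfopen a l"
proof (rule AE_I)
  let ?N = "cbox a (a + (\<chi> i. l)) - halfopen a l"
  show "{x \<in> space lebesgue. \<not> (x \<in> cbox a (a + (\<chi> i. l)) \<longleftrightarrow> x \<in> halfopen a l)} \<subseteq> ?N"
    using halfopen_subset(2)[of a l] by auto
  show "emeasure lebesgue ?N = 0"
    using emeasure_Diff[of lebesgue "halfopen a l" "cbox a (a + (\<chi> i. l))"] halfopen_subset(2)[of a l]
      emeasure_halfopen[OF assms, of a] emeasure_cube(1)[OF assms, of a] by simp
  show "?N \<in> sets lebesgue" by simp
qed

lemma le_mult_of_divide_le_ennreal: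
  fixes a b c :: ennreal
  assumes "a / b \<le> c" "0 < b" "b < top"
  shows "a \<le> c * b"
proof -
  have "a = a / b * b" using assms by (simp add: ennreal_divide_times mult_divide_eq_ennreal)
  also have "\<dots> \<le> c * b" using assms(1) by (intro mult_right_mono) auto
  finally show ?thesis .
qed

text \<open>\<open>maximal\<close> ranges over closed cubes, and the closure of a half-open cube
  competes in it at each of its points. The product form postpones cancellation until the volume is
  known to be positive and finite.\<close>

lemma avg_le_maximal:
  fixes a :: "real ^ 'n"
  assumes "0 < l" "x \<in> halfopen a l"
  shows "(\<integral>\<^sup>+y\<in>halfopen a l. ennreal \<bar>f y\<bar> \<partial>lebesgue) \<le> maximal f x * ennreal (l ^ CARD('n))"
  proof -
  let ?C = "cbox a (a + (\<chi> i. l))"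
  have pos: "0 < l ^ CARD('n)" using assms by simp
  have "(\<integral>\<^sup>+y\<in>?C. ennreal \<bar>f y\<bar> \<partial>lebesgue) / emeasure lebesgue ?C \<le> maximal f x"
    unfolding maximal_def using assms halfopen_subset(2)[of a l]
    by (intro SUP_upper) (auto simp: cubes_def)
  then have "(\<integral>\<^sup>+y\<in>?C. ennreal \<bar>f y\<bar> \<partial>lebesgue) \<le> maximal f x * ennreal (l ^ CARD('n))"
    using emeasure_cube(1)[of l a] assms pos by (intro le_mult_of_divide_le_ennreal) auto
  moreover have "(\<integral>\<^sup>+y\<in>halfopen a l. ennreal \<bar>f y\<bar> \<partial>lebesgue) \<le> (\<integral>\<^sup>+y\<in>?C. ennreal \<bar>f y\<bar> \<partial>lebesgue)"
    using halfopen_subset(2)[of a l] by (intro nn_integral_mono) (auto split: split_indicator)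
  ultimately show ?thesis by simp
qed

section \<open>The dyadic grid, described by integer indices\<close>

definition dyadic_index :: "int \<Rightarrow> real ^ 'n \<Rightarrow> int ^ 'n" where
  "dyadic_index m x = (\<chi> i. \<lfloor>x $ i / 2 powi m\<rfloor>)"

text \<open>The pair \<open>(m, z)\<close> encodes the half-open dyadic cube of side \<open>2^m\<close> with corner \<open>2^m z\<close>.\<close>

definition dyadic :: "int \<times> (int ^ 'n) \<Rightarrow> (real ^ 'n) set" where
  "dyadic d = {x. dyadic_index (fst d) x = snd d}"

text \<open>The concentric dilate of the dyadic cube by the factor 3, a union of \<open>3^n\<close>
  cubes of the same generation. In terms of indices, nesting becomes a matter of integer
  division.\<close>

definition triple :: "int \<times> (int ^ 'n) \<Rightarrow> (real ^ 'n) set" where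
  "triple d = {x. \<forall>i. \<bar>dyadic_index (fst d) x $ i - snd d $ i\<bar> \<le> 1}"

text \<open>Nested floors: rounding at a coarser scale is integer division of the finer index by a
  power of two. The nesting of cubes and of triples rests on this.\<close>

lemma dyadic_index_coarsen:
  assumes "m \<le> m'"
  shows "dyadic_index m' x $ i = dyadic_index m x $ i div 2 ^ nat (m' - m)"
proof -
  have "2 powi m' = 2 powi m * (2::real) ^ nat (m' - m)"
    using assms by (metis add_diff_cancel_left' add_diff_eq diff_ge_0_iff_ge int_nat_eq power_int_add power_int_of_nat zero_neq_numeral)
  then have "x $ i / 2 powi m' = (x $ i / 2 powi m) / real_of_int (2 ^ nat (m' - m))"
    by simp
  then show ?thesis
    unfolding dyadic_index_def
    by (simp only: vec_lambda_beta) (rule floor_divide_real_eq_div, simp)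
qed

lemma dyadic_nested:
  assumes "fst d \<le> fst e" "x \<in> dyadic d" "x \<in> dyadic e"
  shows "dyadic d \<subseteq> dyadic e"
  using assms by (auto simp: dyadic_def vec_eq_iff dyadic_index_coarsen[OF assms(1)])

lemma dyadic_eqI:
  assumes "fst d = fst e" "x \<in> dyadic d" "x \<in> dyadic e"
  shows "d = e"
  using assms by (auto simp: dyadic_def prod_eq_iff)

text \<open>Coarsening cannot separate neighbouring indices, which is why triples inherit the
  nesting of their cubes.\<close>

lemma abs_div_diff_le_1:
  fixes p z N :: int
  assumes "\<bar>p - z\<bar> \<le> 1" "0 < N"
  shows "\<bar>p div N - z div N\<bar> \<le> 1"
proof -
  have "a div N \<le> b div N + 1" if "a \<le> b + 1" for a b :: int
  proof -
    have "a div N \<le> (b + N) div N" using that assms(2) by (intro zdiv_mono1) auto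
    then show ?thesis using assms(2) by simp
  qed
  from this[of p z] this[of z p] assms show ?thesis by linarith
qed

lemma triple_nested:
  assumes "fst d \<le> fst e" "x \<in> dyadic d" "x \<in> dyadic e"
  shows "triple d \<subseteq> triple e"
proof
  fix y assume y: "y \<in> triple d"
  have "\<bar>dyadic_index (fst e) y $ i - snd e $ i\<bar> \<le> 1" for i
  proof -
    have "snd e $ i = snd d $ i div 2 ^ nat (fst e - fst d)"
      using assms dyadic_index_coarsen[OF assms(1), of x i] by (auto simp: dyadic_def)
    then show ?thesis
      using y abs_div_diff_le_1[of "dyadic_index (fst d) y $ i" "snd d $ i" "2 ^ nat (fst e - fst d)"]
      by (simp add: triple_def dyadic_index_coarsen[OF assms(1)])
  qed
  then show "y \<in> triple e" by (simp add: triple_def)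
qed

lemma dyadic_subset_triple: "dyadic d \<subseteq> triple d"
  by (auto simp: dyadic_def triple_def)

lemma dyadic_halfopen:
  "dyadic d = halfopen (\<chi> i. of_int (snd d $ i) * 2 powi fst d) (2 powi fst d)"
proof -
  have "\<lfloor>r / 2 powi m\<rfloor> = z \<longleftrightarrow> of_int z * 2 powi m \<le> r \<and> r < of_int z * 2 powi m + 2 powi m" for r :: real and z m
    by (simp add: floor_eq_iff pos_le_divide_eq pos_divide_less_eq ring_distribs)
  then show ?thesis
    by (simp add: dyadic_def halfopen_def dyadic_index_def vec_eq_iff)
qed

lemma triple_halfopen:
  "triple d = halfopen (\<chi> i. of_int (snd d $ i - 1) * 2 powi fst d) (3 * 2 powi fst d)"
proof -
  have "\<bar>\<lfloor>r / 2 powi m\<rfloor> - z\<bar> \<le> 1 \<longleftrightarrow>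
      of_int (z - 1) * 2 powi m \<le> r \<and> r < of_int (z - 1) * 2 powi m + 3 * 2 powi m" for r :: real and z m
  proof -
    have "\<bar>\<lfloor>r / 2 powi m\<rfloor> - z\<bar> \<le> 1 \<longleftrightarrow> z - 1 \<le> \<lfloor>r / 2 powi m\<rfloor> \<and> \<lfloor>r / 2 powi m\<rfloor> < z + 2"
      by linarith
    also have "\<dots> \<longleftrightarrow> of_int (z - 1) \<le> r / 2 powi m \<and> r / 2 powi m < of_int (z + 2)"
      by (simp only: le_floor_iff floor_less_iff)
    also have "\<dots> \<longleftrightarrow> of_int (z - 1) * 2 powi m \<le> r \<and> r < of_int (z - 1) * 2 powi m + 3 * 2 powi m"
      by (simp add: pos_le_divide_eq pos_divide_less_eq ring_distribs add.commute)
    finally show ?thesis .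
  qed
  then show ?thesis
    by (simp add: triple_def halfopen_def dyadic_index_def)
qed

lemma dyadic_measurable [measurable]: "dyadic d \<in> sets lebesgue"
  by (simp add: dyadic_halfopen)

lemma triple_measurable [measurable]: "triple d \<in> sets lebesgue"
  by (simp add: triple_halfopen)

lemma emeasure_dyadic:
  "emeasure lebesgue (dyadic d) = ennreal ((2 powi fst d) ^ CARD('n))"
  for d :: "int \<times> (int ^ 'n)"
  unfolding dyadic_halfopen by (rule emeasure_halfopen(1)) simp

lemma emeasure_triple:
  "emeasure lebesgue (triple d) = ennreal (3 ^ CARD('n)) * emeasure lebesgue (dyadic d)"
  for d :: "int \<times> (int ^ 'n)"
  unfolding triple_halfopen dyadic_halfopen
  by (subst (1 2) emeasure_halfopen(1)) (simp_all add: power_mult_distrib ennreal_mult)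

text \<open>With \<open>l < 2^m \<le> 2 l\<close> the cube is covered by \<open>2^n\<close> dyadic
  cubes of generation \<open>m\<close>, and \<open>x\<close> lies in the triple of each. If all of
  them violated the bound, adding up would contradict the hypothesis on \<open>c\<close>;
  \<open>4^n\<close> is the number of cubes times the volume ratio \<open>2^n\<close>.\<close>

lemma cube_cover_dyadic:
  fixes a :: "real ^ 'n" and g :: "real ^ 'n \<Rightarrow> ennreal"
  assumes "0 < l" and x: "x \<in> cbox a (a + (\<chi> i. l))"
    and g [measurable]: "g \<in> borel_measurable lebesgue"
    and c: "c * ennreal (l ^ CARD('n)) < (\<integral>\<^sup>+y\<in>cbox a (a + (\<chi> i. l)). g y \<partial>lebesgue)"
  shows "\<exists>d. x \<in> triple d \<and>
    c * emeasure lebesgue (dyadic d) < ennreal (4 ^ CARD('n)) * (\<integral>\<^sup>+y\<in>dyadic d. g y \<partial>lebesgue)"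
proof (rule ccontr)
  assume neg: "\<not> ?thesis"
  let ?C = "cbox a (a + (\<chi> i. l))"
  define m where "m = \<lfloor>log 2 l\<rfloor> + 1"
  have m1: "l < 2 powi m"
  proof -
    have "log 2 l < of_int m" by (simp add: m_def)
    then have "l < 2 powr of_int m" using assms(1) by (simp add: log_less_iff)
    then show ?thesis by (simp add: powr_real_of_int')
  qed
  have m2: "2 powi m \<le> 2 * l"
  proof -
    have "of_int (m - 1) \<le> log 2 l" by (simp add: m_def)
    then have "2 powr of_int (m - 1) \<le> l" using assms(1) by (simp add: le_log_iff)
    then have "2 powi (m - 1) \<le> l" by (simp add: powr_real_of_int' del: of_int_diff)
    then show ?thesis by (simp add: power_int_diff)
  qed
  define p where "p = dyadic_index m a"
  \<comment> \<open>\<open>S\<close> is the set of coordinates in which the index exceeds that of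
    the corner \<open>a\<close> by one, so subsets of coordinates enumerate the covering
    cubes.\<close>
  define D where "D S = (m, \<chi> i. p $ i + (if i \<in> S then 1 else 0))" for S :: "'n set"
  have near: "dyadic_index m y $ i = p $ i \<or> dyadic_index m y $ i = p $ i + 1" if "y \<in> ?C" for y i
  proof -
    have "a $ i / 2 powi m \<le> y $ i / 2 powi m" "y $ i / 2 powi m < a $ i / 2 powi m + 1"
      using that m1 by (auto simp: mem_box_cart divide_simps) (smt (verit) cbox_sidelength)+
    then have "\<lfloor>a $ i / 2 powi m\<rfloor> \<le> \<lfloor>y $ i / 2 powi m\<rfloor>" "\<lfloor>y $ i / 2 powi m\<rfloor> \<le> \<lfloor>a $ i / 2 powi m\<rfloor> + 1"
      by linarith+
    then show ?thesis unfolding p_def dyadic_index_def by auto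
  qed
  have cover: "\<exists>S. y \<in> dyadic (D S)" if "y \<in> ?C" for y
    using near[OF that]
    by (intro exI[of _ "{i. dyadic_index m y $ i = p $ i + 1}"])
      (auto simp: dyadic_def D_def vec_eq_iff)
  have x_triple: "x \<in> triple (D S)" for S
  proof -
    have "\<bar>dyadic_index m x $ i - (p $ i + (if i \<in> S then 1 else 0))\<bar> \<le> 1" for i
      using near[OF x, of i] by auto
    then show ?thesis by (simp add: triple_def D_def)
  qed
  have small: "ennreal (4 ^ CARD('n)) * (\<integral>\<^sup>+y\<in>dyadic (D S). g y \<partial>lebesgue)
      \<le> c * ennreal ((2 * l) ^ CARD('n))" for S
  proof -
    have "ennreal (4 ^ CARD('n)) * (\<integral>\<^sup>+y\<in>dyadic (D S). g y \<partial>lebesgue)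
        \<le> c * emeasure lebesgue (dyadic (D S))"
      using neg x_triple[of S] by (meson not_less)
    also have "\<dots> \<le> c * ennreal ((2 * l) ^ CARD('n))"
    proof (intro mult_left_mono)
      show "emeasure lebesgue (dyadic (D S)) \<le> ennreal ((2 * l) ^ CARD('n))"
        unfolding emeasure_dyadic D_def fst_conv by (intro ennreal_leI power_mono m2) simp
    qed simp
    finally show ?thesis .
  qed
  have "(\<integral>\<^sup>+y\<in>?C. g y \<partial>lebesgue) \<le> (\<integral>\<^sup>+y. (\<Sum>S\<in>UNIV. g y * indicator (dyadic (D S)) y) \<partial>lebesgue)"
  proof (intro nn_integral_mono)
    fix y
    show "g y * indicator ?C y \<le> (\<Sum>S\<in>UNIV. g y * indicator (dyadic (D S)) y)"
    proof (cases "y \<in> ?C")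
      case True
      then obtain S where "y \<in> dyadic (D S)" using cover by blast
      then show ?thesis using True
        by (intro order_trans[OF _ member_le_sum[of S]]) auto
    qed auto
  qed
  also have "\<dots> = (\<Sum>S\<in>UNIV. \<integral>\<^sup>+y\<in>dyadic (D S). g y \<partial>lebesgue)"
    by (intro nn_integral_sum) measurable
  finally have "ennreal (4 ^ CARD('n)) * (\<integral>\<^sup>+y\<in>?C. g y \<partial>lebesgue)
      \<le> ennreal (4 ^ CARD('n)) * (\<Sum>S\<in>UNIV. \<integral>\<^sup>+y\<in>dyadic (D S). g y \<partial>lebesgue)"
    by (intro mult_left_mono) auto
  also have "\<dots> \<le> (\<Sum>S\<in>(UNIV::'n set set). c * ennreal ((2 * l) ^ CARD('n)))"
    unfolding sum_distrib_left by (intro sum_mono small)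
  also have "\<dots> = ennreal (2 ^ CARD('n)) * (c * ennreal ((2 * l) ^ CARD('n)))"
    using card_Pow[of "UNIV :: 'n set"] by (simp add: ennreal_of_nat_eq_real_of_nat)
  also have "\<dots> = ennreal (4 ^ CARD('n)) * (c * ennreal (l ^ CARD('n)))"
  proof -
    have "(4::real) ^ CARD('n) = 2 ^ CARD('n) * 2 ^ CARD('n)"
      using power_mult_distrib[of "2::real" 2 "CARD('n)"] by simp
    then have "ennreal (2 ^ CARD('n)) * ennreal ((2 * l) ^ CARD('n)) = ennreal (4 ^ CARD('n)) * ennreal (l ^ CARD('n))"
      using assms(1) by (simp add: power_mult_distrib mult.assoc flip: ennreal_mult)
    then show ?thesis by (simp only: mult.left_commute[of _ c])
  qed
  finally have "(\<integral>\<^sup>+y\<in>?C. g y \<partial>lebesgue) \<le> c * ennreal (l ^ CARD('n))"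
    by (subst (asm) ennreal_mult_le_mult_iff) auto
  then show False using c by simp
qed

section \<open>Weights and their constants\<close>

lemma sets_weighted [simp, measurable_cong]: "sets (weighted w) = sets lebesgue"
  and space_weighted [simp]: "space (weighted w) = UNIV"
  by (simp_all add: weighted_def)

lemma weight_measurable: "weight w \<Longrightarrow> w \<in> borel_measurable lebesgue"
  and weight_nonneg: "weight w \<Longrightarrow> 0 \<le> w x"
  and weight_AE_pos: "weight w \<Longrightarrow> AE x in lebesgue. 0 < w x"
  by (simp_all add: weight_def)

lemma emeasure_weighted:
  assumes "w \<in> borel_measurable lebesgue" "A \<in> sets lebesgue"
  shows "emeasure (weighted w) A = (\<integral>\<^sup>+x\<in>A. ennreal (w x) \<partial>lebesgue)"
  unfolding weighted_def using assms by (intro emeasure_density) measurable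

lemma weight_cbox_finite:
  assumes "weight w"
  shows "(\<integral>\<^sup>+x\<in>cbox a b. ennreal (w x) \<partial>lebesgue) < top"
proof -
  have "integrable lebesgue (\<lambda>x. indicator (cbox a b) x *\<^sub>R w x)"
    using assms by (auto simp: weight_def set_integrable_def)
  then have "(\<integral>\<^sup>+x. ennreal (norm (indicator (cbox a b) x *\<^sub>R w x)) \<partial>lebesgue) < top"
    by (simp add: integrable_iff_bounded)
  also have "(\<integral>\<^sup>+x. ennreal (norm (indicator (cbox a b) x *\<^sub>R w x)) \<partial>lebesgue)
      = (\<integral>\<^sup>+x\<in>cbox a b. ennreal (w x) \<partial>lebesgue)"
    using weight_nonneg[OF assms] by (intro nn_integral_cong) (auto split: split_indicator)
  finally show ?thesis .
qed

lemma weight_halfopen_finite: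
  assumes "weight w"
  shows "emeasure (weighted w) (halfopen a l) < top"
proof -
  have "emeasure (weighted w) (halfopen a l) \<le> emeasure (weighted w) (cbox a (a + (\<chi> i. l)))"
    using halfopen_subset(2) by (intro emeasure_mono) auto
  also have "\<dots> < top"
    using weight_cbox_finite[OF assms] emeasure_weighted[OF weight_measurable[OF assms]] by simp
  finally show ?thesis .
qed

lemma weight_emeasure_pos:
  assumes "weight w" and A: "A \<in> sets lebesgue" "0 < emeasure lebesgue A"
  shows "0 < emeasure (weighted w) A"
proof (rule ccontr)
  note [measurable] = weight_measurable[OF assms(1)] A(1)
  assume "\<not> ?thesis"
  then have "(\<integral>\<^sup>+x\<in>A. ennreal (w x) \<partial>lebesgue) = 0"
    using emeasure_weighted[OF weight_measurable[OF assms(1)] A(1)] by simp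
  then have "AE x in lebesgue. ennreal (w x) * indicator A x = 0"
    by (subst (asm) nn_integral_0_iff_AE) measurable
  with weight_AE_pos[OF assms(1)] have "AE x in lebesgue. x \<notin> A"
    by eventually_elim (auto split: split_indicator_asm)
  then have "emeasure lebesgue A = 0"
    using A(1) by (subst (asm) AE_iff_measurable[of A]) auto
  then show False using A(2) by simp
qed

section \<open>The A1 condition on half-open cubes\<close>

lemma A1_weightD: "A1_weight u \<Longrightarrow> weight u"
  by (simp add: A1_weight_def)

lemma A1_weight_AE_maximal_le:
  assumes "A1_weight u"
  shows "AE x in lebesgue. maximal u x \<le> A1_const u * ennreal (u x)"
  using esssup_AE[of "\<lambda>x. maximal u x / ennreal (u x)" lebesgue] weight_AE_pos[OF A1_weightD[OF assms]]
  unfolding A1_const_def[symmetric]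
  by eventually_elim (rule le_mult_of_divide_le_ennreal; simp)

lemma A1_weight_AE_avg_le:
  fixes a :: "real ^ 'n"
  assumes "A1_weight u" "0 < l"
  shows "AE x in lebesgue. x \<in> halfopen a l \<longrightarrow>
    emeasure (weighted u) (halfopen a l) \<le> A1_const u * ennreal (u x) * emeasure lebesgue (halfopen a l)"
  using A1_weight_AE_maximal_le[OF assms(1)]
proof eventually_elim
  case (elim x)
  note u = A1_weightD[OF assms(1)]
  show ?case
  proof
    assume x: "x \<in> halfopen a l"
    have "emeasure (weighted u) (halfopen a l) = (\<integral>\<^sup>+x\<in>halfopen a l. ennreal \<bar>u x\<bar> \<partial>lebesgue)"
      using weight_nonneg[OF u] by (simp add: emeasure_weighted[OF weight_measurable[OF u]])
    also have "\<dots> \<le> maximal u x * ennreal (l ^ CARD('n))"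
      by (rule avg_le_maximal[OF assms(2) x])
    also have "\<dots> \<le> A1_const u * ennreal (u x) * emeasure lebesgue (halfopen a l)"
      using elim assms(2) by (auto simp: emeasure_halfopen intro!: mult_right_mono)
    finally show "emeasure (weighted u) (halfopen a l) \<le> A1_const u * ennreal (u x) * emeasure lebesgue (halfopen a l)" .
  qed
qed

text \<open>Integration over \<open>B\<close> of the almost everywhere bound for the average of
  \<open>u\<close>. It gives a lower bound for the share of \<open>B\<close> in the
  \<open>u\<close>-mass of the cube by its share in the volume, up to the A1 constant.\<close>

lemma A1_weight_subset:
  fixes a :: "real ^ 'n"
  assumes "A1_weight u" "0 < l" and B: "B \<in> sets lebesgue" "B \<subseteq> halfopen a l"
  shows "emeasure (weighted u) (halfopen a l) * emeasure lebesgue B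
    \<le> A1_const u * emeasure (weighted u) B * emeasure lebesgue (halfopen a l)"
proof -
  let ?H = "halfopen a l"
  note [measurable] = weight_measurable[OF A1_weightD[OF assms(1)]] B(1)
  have "emeasure (weighted u) ?H * emeasure lebesgue B = (\<integral>\<^sup>+x\<in>B. emeasure (weighted u) ?H \<partial>lebesgue)"
    by (simp add: nn_integral_cmult_indicator)
  also have "\<dots> \<le> (\<integral>\<^sup>+x. (A1_const u * emeasure lebesgue ?H) * (ennreal (u x) * indicator B x) \<partial>lebesgue)"
    using A1_weight_AE_avg_le[OF assms(1,2), of a] B(2)
    by (intro nn_integral_mono_AE) (auto elim!: eventually_mono split: split_indicator simp: mult_ac)
  also have "\<dots> = A1_const u * emeasure lebesgue ?H * emeasure (weighted u) B"
    by (subst nn_integral_cmult) (simp_all add: emeasure_weighted)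
  finally show ?thesis by (simp add: mult_ac)
qed

text \<open>The whole unit cube is taken as \<open>B\<close> in \<open>A1_weight_subset\<close>; its
  \<open>u\<close>-mass is positive and finite and cancels.\<close>

lemma A1_const_ge_1:
  assumes "A1_weight (u :: real ^ 'n \<Rightarrow> real)"
  shows "1 \<le> A1_const u"
proof -
  let ?H = "halfopen (0 :: real ^ 'n) 1"
  note u = A1_weightD[OF assms]
  have H: "emeasure lebesgue ?H = 1" by (simp add: emeasure_halfopen)
  have pos: "0 < emeasure (weighted u) ?H" by (rule weight_emeasure_pos[OF u]) (simp_all add: H)
  have "emeasure (weighted u) ?H * 1 \<le> emeasure (weighted u) ?H * A1_const u"
    using A1_weight_subset[OF assms, of 1 ?H 0] H by (simp add: mult.commute)
  then show ?thesis
    using pos weight_halfopen_finite[OF u, of 0 1] by (subst (asm) ennreal_mult_le_mult_iff) auto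
qed

section \<open>The Fujii--Wilson constant on half-open cubes\<close>

lemma maximal_mono: "(\<And>y. \<bar>f y\<bar> \<le> \<bar>g y\<bar>) \<Longrightarrow> maximal f x \<le> maximal g x"
  unfolding maximal_def
  by (intro SUP_mono') (intro divide_right_mono_ennreal nn_integral_mono mult_right_mono ennreal_leI, auto)

text \<open>Closed and half-open cubes differ by a null set, so the denominators agree, and
  enlarging the truncation only increases the maximal function.\<close>

lemma Ainf_halfopen:
  fixes a :: "real ^ 'n"
  assumes v: "weight v" and "0 < l"
  shows "(\<integral>\<^sup>+x\<in>halfopen a l. maximal (\<lambda>y. v y * indicator (halfopen a l) y) x \<partial>lebesgue)
    \<le> Ainf_const v * emeasure (weighted v) (halfopen a l)"
proof -
  let ?H = "halfopen a l" and ?C = "cbox a (a + (\<chi> i. l))"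
  note [measurable] = weight_measurable[OF v]
  have 1: "(\<integral>\<^sup>+x\<in>?C. ennreal (v x) \<partial>lebesgue) = emeasure (weighted v) ?H"
    unfolding emeasure_weighted[OF weight_measurable[OF v] halfopen_lebesgue] using AE_halfopen_cbox[of l a] assms(2)
    by (intro nn_integral_cong_AE) (auto elim!: eventually_mono split: split_indicator)
  have pos: "0 < emeasure (weighted v) ?H"
    using assms(2) by (intro weight_emeasure_pos[OF v]) (simp_all add: emeasure_halfopen)
  have "(\<integral>\<^sup>+x\<in>?H. maximal (\<lambda>y. v y * indicator ?H y) x \<partial>lebesgue)
    \<le> (\<integral>\<^sup>+x\<in>?C. maximal (\<lambda>y. v y * indicator ?C y) x \<partial>lebesgue)"
    using halfopen_subset(2)[of a l]
    by (intro nn_integral_mono mult_mono maximal_mono) (auto split: split_indicator)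
  moreover have "(\<integral>\<^sup>+x\<in>?C. maximal (\<lambda>y. v y * indicator ?C y) x \<partial>lebesgue) /
      (\<integral>\<^sup>+x\<in>?C. ennreal (v x) \<partial>lebesgue) \<le> Ainf_const v"
    unfolding Ainf_const_def using assms(2) by (intro SUP_upper) (auto simp: cubes_def)
  ultimately show ?thesis
    unfolding 1 using le_mult_of_divide_le_ennreal[OF _ pos weight_halfopen_finite[OF v]] by (meson order_trans)
qed

text \<open>On the unit cube the localised maximal function is at least the average of
  \<open>v\<close> over that same cube, which equals its \<open>v\<close>-mass because the volume is
  1.\<close>

lemma Ainf_const_ge_1:
  assumes v: "weight (v :: real ^ 'n \<Rightarrow> real)"
  shows "1 \<le> Ainf_const v"
proof -
  let ?H = "halfopen (0 :: real ^ 'n) 1"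
  have H: "emeasure lebesgue ?H = 1" by (simp add: emeasure_halfopen)
  have pos: "0 < emeasure (weighted v) ?H" by (rule weight_emeasure_pos[OF v]) (simp_all add: H)
  have "emeasure (weighted v) ?H = (\<integral>\<^sup>+x\<in>?H. emeasure (weighted v) ?H \<partial>lebesgue)"
    using H by (simp add: nn_integral_cmult_indicator)
  also have "\<dots> \<le> (\<integral>\<^sup>+x\<in>?H. maximal (\<lambda>y. v y * indicator ?H y) x \<partial>lebesgue)"
  proof (intro nn_integral_mono)
    fix x
    have "emeasure (weighted v) ?H = (\<integral>\<^sup>+y\<in>?H. ennreal \<bar>v y * indicator ?H y\<bar> \<partial>lebesgue)"
      unfolding emeasure_weighted[OF weight_measurable[OF v] halfopen_lebesgue] using weight_nonneg[OF v]
      by (intro nn_integral_cong) (auto split: split_indicator)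
    then show "emeasure (weighted v) ?H * indicator ?H x \<le> maximal (\<lambda>y. v y * indicator ?H y) x * indicator ?H x"
      using avg_le_maximal[of 1 x 0 "\<lambda>y. v y * indicator ?H y"] by (auto split: split_indicator)
  qed
  also have "\<dots> \<le> Ainf_const v * emeasure (weighted v) ?H"
    by (rule Ainf_halfopen[OF v]) simp
  finally have "emeasure (weighted v) ?H * 1 \<le> emeasure (weighted v) ?H * Ainf_const v"
    by (simp add: mult.commute)
  then show ?thesis
    using pos weight_halfopen_finite[OF v, of 0 1] by (subst (asm) ennreal_mult_le_mult_iff) auto
qed

section \<open>Decay of an A1 weight on small sets\<close>

lemma emeasure_UN_mono_disjoint:
  assumes "countable S" "disjoint_family_on A S" "disjoint_family_on B S"
    and "\<And>d. d \<in> S \<Longrightarrow> A d \<in> sets M" "\<And>d. d \<in> S \<Longrightarrow> B d \<in> sets N"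
    and le: "\<And>d. d \<in> S \<Longrightarrow> a * emeasure M (A d) \<le> b * emeasure N (B d)"
  shows "a * emeasure M (\<Union>d\<in>S. A d) \<le> b * emeasure N (\<Union>d\<in>S. B d)"
proof -
  have "a * emeasure M (\<Union>d\<in>S. A d) = (\<integral>\<^sup>+d. a * emeasure M (A d) \<partial>count_space S)"
    using assms by (simp add: emeasure_UN_countable nn_integral_cmult)
  also have "\<dots> \<le> (\<integral>\<^sup>+d. b * emeasure N (B d) \<partial>count_space S)"
    by (intro nn_integral_mono) (simp add: le)
  also have "\<dots> = b * emeasure N (\<Union>d\<in>S. B d)"
    using assms by (simp add: emeasure_UN_countable nn_integral_cmult)
  finally show ?thesis .
qed

lemma emeasure_dyadic_pos: "0 < emeasure lebesgue (dyadic d)"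
  and emeasure_dyadic_finite: "emeasure lebesgue (dyadic d) < top"
  by (simp_all add: emeasure_dyadic)

lemma emeasure_dyadic_parent:
  fixes d e :: "int \<times> (int ^ 'n)"
  assumes "fst e = fst d + 1"
  shows "emeasure lebesgue (dyadic e) = ennreal (2 ^ CARD('n)) * emeasure lebesgue (dyadic d)"
proof -
  have "(2 powi (fst d + 1) :: real) ^ CARD('n) = 2 ^ CARD('n) * (2 powi fst d) ^ CARD('n)" for d :: "int \<times> (int ^ 'n)"
    by (simp add: power_int_add power_mult_distrib mult.commute)
  then show ?thesis by (simp add: emeasure_dyadic assms ennreal_mult)
qed

text \<open>The complement of \<open>G\<close> in the cube has at least half the volume, so by
  \<open>A1_weight_subset\<close> it keeps at least the fraction \<open>1 / (2 U)\<close> of the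
  \<open>u\<close>-mass, and \<open>G\<close> gets the rest.\<close>

lemma A1_weight_half:
  fixes d :: "int \<times> (int ^ 'n)"
  assumes "A1_weight u" and U: "A1_const u = ennreal U" and G: "G \<in> sets lebesgue"
    and half: "emeasure lebesgue (G \<inter> dyadic d) \<le> ennreal (1/2) * emeasure lebesgue (dyadic d)"
  shows "emeasure (weighted u) (G \<inter> dyadic d) \<le> ennreal (1 - 1 / (2 * U)) * emeasure (weighted u) (dyadic d)"
proof -
  let ?H = "dyadic d" and ?B = "dyadic d - G"
  note u = A1_weightD[OF assms(1)]
  have U1: "1 \<le> U"
    using A1_const_ge_1[OF assms(1)] U by (simp add: ennreal_ge_1)
  have fin: "emeasure (weighted u) ?H < top"
    unfolding dyadic_halfopen by (rule weight_halfopen_finite[OF u])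
  define q where "q = (2 powi fst d :: real) ^ CARD('n)"
  have q: "0 < q" "emeasure lebesgue ?H = ennreal q"
    by (simp_all add: q_def emeasure_dyadic)
  have fin': "emeasure M X < top" if "X \<subseteq> ?H" "emeasure M ?H < top" "?H \<in> sets M" for M X
    using that emeasure_mono[of X ?H M] by (meson le_less_trans)
  \<comment> \<open>Passage to real numbers, where subtraction behaves well: \<open>x\<close>,
    \<open>y\<close>, \<open>w\<close> are the \<open>u\<close>-masses of the cube, of its part
    outside \<open>G\<close> and of its part inside, while \<open>q\<close>, \<open>b\<close>,
    \<open>g\<close> are the corresponding volumes.\<close>
  obtain x where x: "emeasure (weighted u) ?H = ennreal x" "0 \<le> x"
    using fin by (metis ennreal_cases less_irrefl infinity_ennreal_def)
  obtain y where y: "emeasure (weighted u) ?B = ennreal y" "0 \<le> y"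
    using fin'[of ?B "weighted u"] fin by (metis Diff_subset dyadic_measurable sets_weighted ennreal_cases less_irrefl infinity_ennreal_def)
  obtain w where w: "emeasure (weighted u) (G \<inter> ?H) = ennreal w" "0 \<le> w"
    using fin'[of "G \<inter> ?H" "weighted u"] fin by (metis Int_lower2 dyadic_measurable sets_weighted ennreal_cases less_irrefl infinity_ennreal_def)
  obtain b where b: "emeasure lebesgue ?B = ennreal b" "0 \<le> b"
    using fin'[of ?B lebesgue] emeasure_dyadic_finite by (metis Diff_subset dyadic_measurable ennreal_cases less_irrefl infinity_ennreal_def)
  obtain g where g: "emeasure lebesgue (G \<inter> ?H) = ennreal g" "0 \<le> g"
    using fin'[of "G \<inter> ?H" lebesgue] emeasure_dyadic_finite by (metis Int_lower2 dyadic_measurable ennreal_cases less_irrefl infinity_ennreal_def)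
  have split: "emeasure M ?H = emeasure M (G \<inter> ?H) + emeasure M ?B" if "sets M = sets lebesgue" for M
  proof -
    have "?H = (G \<inter> ?H) \<union> ?B" by auto
    then show ?thesis using G that by (subst plus_emeasure) (auto simp: Int_Diff)
  qed
  have "ennreal x = ennreal w + ennreal y" using split[of "weighted u"] x w y by simp
  then have xwy: "x = w + y" using x w y by (simp flip: ennreal_plus)
  have "ennreal q = ennreal g + ennreal b" using split[of lebesgue] q(2) g b by simp
  then have qgb: "q = g + b" using q g b by (simp flip: ennreal_plus)
  have "ennreal g \<le> ennreal (1/2) * ennreal q" using half unfolding g(1) q(2) .
  also have "\<dots> = ennreal (1/2 * q)" using q(1) by (intro ennreal_mult[symmetric]) auto
  finally have "g \<le> q / 2" using q(1) by (subst (asm) ennreal_le_iff) auto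
  then have bq: "q / 2 \<le> b" using qgb by simp
  have "ennreal x * ennreal b \<le> ennreal U * ennreal y * ennreal q"
    using A1_weight_subset[OF assms(1), of "2 powi fst d" ?B "\<chi> i. of_int (snd d $ i) * 2 powi fst d"] G
    unfolding dyadic_halfopen[symmetric] by (simp add: x y b q(2) U del: emeasure_completion)
  then have "x * b \<le> U * y * q" using x y b q U1 by (simp flip: ennreal_mult)
  then have "x * (q / 2) \<le> U * y * q" using bq x(2) by (meson mult_left_mono order_trans)
  then have "x \<le> 2 * U * y" using q(1) by (simp add: field_simps)
  then have "w \<le> (1 - 1 / (2 * U)) * x" using xwy U1 by (simp add: field_simps)
  then show ?thesis unfolding w(1) x(1) by (simp only: ennreal_mult''[OF x(2), symmetric] ennreal_leI)
qed

text \<open>Openness in the topology generated by the dyadic cubes. Small dyadic cubes around each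
  point lie inside the set, so stopping cubes cover it without an exceptional null set. Unions of
  dyadic cubes have the property, which lets the iteration continue.\<close>

definition dyadic_open :: "(real ^ 'n) set \<Rightarrow> bool" where
  "dyadic_open G \<longleftrightarrow> (\<forall>x\<in>G. \<exists>d. x \<in> dyadic d \<and> dyadic d \<subseteq> G)"

lemma mem_dyadic_index: "x \<in> dyadic (m, dyadic_index m x)"
  by (simp add: dyadic_def)

lemma dyadic_subset_index:
  assumes "x \<in> dyadic d" "fst d \<le> m"
  shows "dyadic d \<subseteq> dyadic (m, dyadic_index m x)"
  using assms dyadic_nested[of d "(m, dyadic_index m x)" x] mem_dyadic_index by auto

lemma open_imp_dyadic_open:
  fixes G :: "(real ^ 'n) set"
  assumes "open G"
  shows "dyadic_open G"
  unfolding dyadic_open_def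
proof
  fix x assume "x \<in> G"
  then obtain e where e: "0 < e" "ball x e \<subseteq> G" using assms by (meson open_contains_ball)
  \<comment> \<open>Dividing by the dimension pays for estimating the norm by the sum of the
    coordinate differences.\<close>
  obtain k where k: "(1/2) ^ k < e / CARD('n)"
    using real_arch_pow_inv[of "e / CARD('n)" "1/2"] e by auto
  define m where "m = - int k"
  have m: "2 powi m = (1/2 :: real) ^ k" by (simp add: m_def power_int_minus field_simps)
  have "dyadic (m, dyadic_index m x) \<subseteq> ball x e"
  proof
    fix y assume y: "y \<in> dyadic (m, dyadic_index m x)"
    have "\<bar>(x - y) $ i\<bar> \<le> 2 powi m" for i
    proof -
      have "\<lfloor>y $ i / 2 powi m\<rfloor> = \<lfloor>x $ i / 2 powi m\<rfloor>"
        using y by (simp add: dyadic_def dyadic_index_def vec_eq_iff)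
      then have "\<bar>x $ i / 2 powi m - y $ i / 2 powi m\<bar> \<le> 1" by linarith
      then have "\<bar>(x $ i - y $ i) / 2 powi m\<bar> \<le> 1" by (simp add: diff_divide_distrib)
      then show ?thesis by (simp add: abs_divide)
    qed
    then have "norm (x - y) \<le> (\<Sum>i\<in>(UNIV::'n set). 2 powi m)"
      by (intro order_trans[OF norm_le_l1_cart] sum_mono)
    also have "\<dots> < e" using k by (simp add: m field_simps)
    finally show "y \<in> ball x e" by (simp add: dist_norm)
  qed
  then show "\<exists>d. x \<in> dyadic d \<and> dyadic d \<subseteq> G"
    using e(2) mem_dyadic_index by blast
qed

lemma dyadic_open_Int:
  assumes "dyadic_open A" "dyadic_open B"
  shows "dyadic_open (A \<inter> B)"
  unfolding dyadic_open_def
proof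
  fix x assume "x \<in> A \<inter> B"
  then obtain d e where d: "x \<in> dyadic d" "dyadic d \<subseteq> A" and e: "x \<in> dyadic e" "dyadic e \<subseteq> B"
    using assms unfolding dyadic_open_def by blast
  show "\<exists>d. x \<in> dyadic d \<and> dyadic d \<subseteq> A \<inter> B"
  proof (cases "fst d \<le> fst e")
    case True
    with dyadic_nested[of d e x] d e show ?thesis by blast
  next
    case False
    with dyadic_nested[of e d x] d e show ?thesis by (metis Int_greatest order_trans linear)
  qed
qed

lemma triple_saturated:
  assumes "x \<in> triple d"
  shows "dyadic (fst d, dyadic_index (fst d) x) \<subseteq> triple d"
  using assms by (auto simp: triple_def dyadic_def)

text \<open>Each step of the induction replaces \<open>G\<close> by the union of the stopping cubes of its
  Calderon--Zygmund decomposition at height \<open>2^(-n-1)\<close>: \<open>G\<close> fills at most half of every one of them,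
  and their union is at most \<open>2^(n+1)\<close> times as large as \<open>G\<close>.\<close>

lemma A1_weight_decay_dyadic_open:
  fixes u :: "real ^ 'n \<Rightarrow> real"
  assumes "A1_weight u" and U: "A1_const u = ennreal U"
    and W: "W \<in> sets lebesgue" "\<And>x. x \<in> W \<Longrightarrow> dyadic (s, dyadic_index s x) \<subseteq> W"
    and "G \<in> sets lebesgue" "dyadic_open G" "G \<subseteq> W"
    and "\<And>z. emeasure lebesgue (G \<inter> dyadic (s, z)) \<le>
      ennreal ((1 / 2 ^ Suc CARD('n)) ^ m) * emeasure lebesgue (dyadic (s, z))"
  shows "emeasure (weighted u) G \<le> ennreal ((1 - 1 / (2 * U)) ^ m) * emeasure (weighted u) W"
  using assms(5-8)
proof (induction m arbitrary: G)
  case 0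
  then show ?case using W by (simp add: emeasure_mono)
next
  case (Suc m)
  define r :: real where "r = 1 / 2 ^ Suc CARD('n)"
  have r: "0 < r" "r < 1" "r * 2 ^ CARD('n) = 1 / 2"
    by (simp_all add: r_def)
     (metis one_less_power lessI less_trans one_less_numeral_iff semiring_norm(76) zero_less_Suc power_Suc)
  define P where "P d \<longleftrightarrow> ennreal r * emeasure lebesgue (dyadic d) < emeasure lebesgue (G \<inter> dyadic d)"
    for d :: "int \<times> (int ^ 'n)"
  define S where "S = {d. fst d < s \<and> P d \<and>
    (\<forall>e. fst d < fst e \<longrightarrow> fst e \<le> s \<longrightarrow> dyadic d \<subseteq> dyadic e \<longrightarrow> \<not> P e)}"
  note G = Suc.prems(1)
  \<comment> \<open>The selection starts below generation \<open>s\<close>, so no cube of that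
    generation may satisfy \<open>P\<close>; its density is at most
    \<open>r^(m+1) \<le> r\<close>.\<close>
  have top_level: "\<not> P (s, z)" for z
  proof -
    have "r ^ Suc m \<le> r" using r by (simp add: mult_left_le power_le_one)
    then have "ennreal (r ^ Suc m) * emeasure lebesgue (dyadic (s, z)) \<le> ennreal r * emeasure lebesgue (dyadic (s, z))"
      by (intro mult_right_mono ennreal_leI) auto
    with Suc.prems(4)[of z] show ?thesis unfolding P_def r_def[symmetric] by (meson not_less order_trans)
  qed
  have disj: "d = e" if "d \<in> S" "e \<in> S" "x \<in> dyadic d" "x \<in> dyadic e" for d e x
  proof -
    have "\<not> fst d < fst e" using that dyadic_nested[of d e x] unfolding S_def mem_Collect_eq by (meson less_imp_le)
    moreover have "\<not> fst e < fst d" using that dyadic_nested[of e d x] unfolding S_def mem_Collect_eq by (meson less_imp_le)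
    ultimately show ?thesis using dyadic_eqI[of d e x] that by auto
  qed
  have cover: "\<exists>d\<in>S. x \<in> dyadic d" if x: "x \<in> G" for x
  proof -
    \<comment> \<open>\<open>j\<close> counts generations downwards from \<open>s\<close> along the
      cubes containing \<open>x\<close>; the least \<open>j\<close> with \<open>R j\<close> yields
      the largest stopping cube.\<close>
    define R where "R j = P (s - int j, dyadic_index (s - int j) x)" for j
    obtain d where d: "x \<in> dyadic d" "dyadic d \<subseteq> G"
      using Suc.prems(2) x unfolding dyadic_open_def by blast
    have "\<exists>j. R j"
    proof -
      \<comment> \<open>A cube around \<open>x\<close> inside \<open>G\<close> and not above
        generation \<open>s\<close> has density 1, which exceeds \<open>r\<close>.\<close>
      define k where "k = min s (fst d)"
      have "dyadic (k, dyadic_index k x) \<subseteq> dyadic d"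
        using dyadic_nested[of "(k, dyadic_index k x)" d x] d(1) mem_dyadic_index[of x k] by (simp add: k_def)
      then have "G \<inter> dyadic (k, dyadic_index k x) = dyadic (k, dyadic_index k x)" using d by blast
      moreover have "ennreal r * emeasure lebesgue (dyadic e) < emeasure lebesgue (dyadic e)" for e :: "int \<times> (int ^ 'n)"
        using r by (simp add: emeasure_dyadic ennreal_less_iff flip: ennreal_mult)
      ultimately have "P (k, dyadic_index k x)" unfolding P_def by simp
      then have "R (nat (s - k))" by (simp add: R_def k_def)
      then show ?thesis ..
    qed
    define j where "j = (LEAST j. R j)"
    have j: "R j" using \<open>\<exists>j. R j\<close> unfolding j_def by (rule LeastI_ex)
    have jmin: "\<not> R i" if "i < j" for i using that not_less_Least unfolding j_def by blast
    have "0 < j" using j top_level by (cases j) (auto simp: R_def)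
    let ?d = "(s - int j, dyadic_index (s - int j) x)"
    have "?d \<in> S"
      unfolding S_def
    proof (safe)
      show "fst ?d < s" using \<open>0 < j\<close> by simp
      show "P ?d" using j by (simp add: R_def)
      fix a b assume e: "fst ?d < fst (a, b)" "fst (a, b) \<le> s" "dyadic ?d \<subseteq> dyadic (a, b)" "P (a, b)"
      have "x \<in> dyadic (a, b)" using e(3) mem_dyadic_index by blast
      then have "b = dyadic_index a x" by (simp add: dyadic_def)
      then have "R (nat (s - a))" using e by (simp add: R_def)
      moreover have "nat (s - a) < j" using e by simp
      ultimately show False using jmin by blast
    qed
    then show ?thesis using mem_dyadic_index by blast
  qed
  have meet: "\<exists>y. y \<in> G \<inter> dyadic d" if "d \<in> S" for d
  proof (rule ccontr)
    assume "\<not> ?thesis"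
    then have "G \<inter> dyadic d = {}" by blast
    then show False using that by (simp add: S_def P_def)
  qed
  have half: "emeasure lebesgue (G \<inter> dyadic d) \<le> ennreal (1/2) * emeasure lebesgue (dyadic d)" if d: "d \<in> S" for d
  proof -
    obtain y where y: "y \<in> G" "y \<in> dyadic d" using meet[OF d] by blast
    \<comment> \<open>The parent of \<open>d\<close> has generation at most \<open>s\<close> and
      fails \<open>P\<close> by maximality of \<open>d\<close>; it is \<open>2^n\<close> times as
      large, and \<open>r * 2^n = 1/2\<close>.\<close>
    define e where "e = (fst d + 1, dyadic_index (fst d + 1) y)"
    have de: "dyadic d \<subseteq> dyadic e" unfolding e_def by (rule dyadic_subset_index[OF y(2)]) simp
    have "emeasure lebesgue (G \<inter> dyadic d) \<le> emeasure lebesgue (G \<inter> dyadic e)"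
      using de G by (intro emeasure_mono) auto
    also have "\<dots> \<le> ennreal r * emeasure lebesgue (dyadic e)"
      using d de unfolding S_def P_def by (auto simp: e_def not_less[symmetric])
    also have "\<dots> = ennreal r * (ennreal (2 ^ CARD('n)) * emeasure lebesgue (dyadic d))"
      by (subst emeasure_dyadic_parent[of e d]) (simp_all add: e_def)
    also have "\<dots> = ennreal (1/2) * emeasure lebesgue (dyadic d)"
    proof -
      have "ennreal r * ennreal (2 ^ CARD('n)) = ennreal (1/2)"
        using r(1) by (simp only: ennreal_mult''[symmetric] r(3) zero_le_power zero_le_numeral)
      then show ?thesis by (simp only: mult.assoc[symmetric])
    qed
    finally show ?thesis .
  qed
  define G1 where "G1 = (\<Union>d\<in>S. dyadic d)"
  have cS: "countable S" by simp
  have G1: "G1 \<in> sets lebesgue"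
    unfolding G1_def by (intro sets.countable_UN'') auto
  have G1W: "G1 \<subseteq> W"
  proof
    fix x assume "x \<in> G1"
    then obtain d where d: "d \<in> S" "x \<in> dyadic d" unfolding G1_def by blast
    obtain y where y: "y \<in> G" "y \<in> dyadic d" using meet[OF d(1)] by blast
    have "dyadic d \<subseteq> dyadic (s, dyadic_index s y)"
      by (rule dyadic_subset_index[OF y(2)]) (use d in \<open>simp add: S_def\<close>)
    then show "x \<in> W" using W(2)[of y] y Suc.prems(3) d by blast
  qed
  \<comment> \<open>Each stopping cube has at most \<open>1/r\<close> times the volume of its part
    in \<open>G\<close>, so passing from \<open>G\<close> to \<open>G1\<close> costs one factor
    \<open>r\<close> and lowers the exponent from \<open>Suc m\<close> to \<open>m\<close>.\<close>
  have small: "emeasure lebesgue (G1 \<inter> dyadic (s, z)) \<le> ennreal (r ^ m) * emeasure lebesgue (dyadic (s, z))" for z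
  proof -
    define Sz where "Sz = {d\<in>S. dyadic d \<subseteq> dyadic (s, z)}"
    have eq: "G1 \<inter> dyadic (s, z) = (\<Union>d\<in>Sz. dyadic d)"
    proof -
      have "dyadic d \<subseteq> dyadic (s, z)" if "d \<in> S" "x \<in> dyadic d" "x \<in> dyadic (s, z)" for d x
        using dyadic_nested[of d "(s, z)" x] that by (auto simp: S_def)
      then show ?thesis unfolding G1_def Sz_def by blast
    qed
    have "ennreal r * emeasure lebesgue (\<Union>d\<in>Sz. dyadic d) \<le> 1 * emeasure lebesgue (\<Union>d\<in>Sz. G \<inter> dyadic d)"
    proof (rule emeasure_UN_mono_disjoint)
      show "disjoint_family_on dyadic Sz" "disjoint_family_on (\<lambda>d. G \<inter> dyadic d) Sz"
        using disj unfolding disjoint_family_on_def Sz_def by blast+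
      fix d assume "d \<in> Sz"
      then show "ennreal r * emeasure lebesgue (dyadic d) \<le> 1 * emeasure lebesgue (G \<inter> dyadic d)"
        unfolding Sz_def S_def P_def by (simp add: less_imp_le del: emeasure_completion)
    qed (use G in auto)
    also have "\<dots> \<le> 1 * emeasure lebesgue (G \<inter> dyadic (s, z))"
      using G by (intro mult_left_mono emeasure_mono) (auto simp: Sz_def)
    also have "\<dots> \<le> ennreal (r ^ Suc m) * emeasure lebesgue (dyadic (s, z))"
      using Suc.prems(4)[of z] by (simp add: r_def del: emeasure_completion power_Suc)
    also have "\<dots> = ennreal r * (ennreal (r ^ m) * emeasure lebesgue (dyadic (s, z)))"
      using r by (simp add: ennreal_mult mult.assoc del: emeasure_completion)
    finally show ?thesis
      unfolding eq using r by (subst (asm) ennreal_mult_le_mult_iff) auto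
  qed
  have U1: "1 \<le> U"
    using A1_const_ge_1[OF assms(1)] U by (simp add: ennreal_ge_1)
  have "1 * emeasure (weighted u) (\<Union>d\<in>S. G \<inter> dyadic d)
      \<le> ennreal (1 - 1 / (2 * U)) * emeasure (weighted u) (\<Union>d\<in>S. dyadic d)"
  proof (rule emeasure_UN_mono_disjoint)
    show "disjoint_family_on dyadic S" "disjoint_family_on (\<lambda>d. G \<inter> dyadic d) S"
      using disj unfolding disjoint_family_on_def by blast+
    show "1 * emeasure (weighted u) (G \<inter> dyadic d) \<le> ennreal (1 - 1 / (2 * U)) * emeasure (weighted u) (dyadic d)"
      if "d \<in> S" for d
      using A1_weight_half[OF assms(1) U G half[OF that]] by simp
  qed (use G in auto)
  also have "(\<Union>d\<in>S. G \<inter> dyadic d) = G" using cover by blast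
  also have "(\<Union>d\<in>S. dyadic d) = G1" by (simp add: G1_def)
  finally have "emeasure (weighted u) G \<le> ennreal (1 - 1 / (2 * U)) * emeasure (weighted u) G1" by simp
  also have "\<dots> \<le> ennreal (1 - 1 / (2 * U)) * (ennreal ((1 - 1 / (2 * U)) ^ m) * emeasure (weighted u) W)"
  proof (intro mult_left_mono Suc.IH G1 G1W)
    show "dyadic_open G1" unfolding dyadic_open_def G1_def by blast
  qed (use small in \<open>simp_all add: r_def del: emeasure_completion\<close>)
  also have "\<dots> = ennreal ((1 - 1 / (2 * U)) ^ Suc m) * emeasure (weighted u) W"
    using U1 by (simp add: ennreal_mult mult.assoc)
  finally show ?case .
qed

text \<open>Outer regularity replaces \<open>E\<close> by an open, hence dyadically open, set whose
  volume stays within the threshold; the strict inequality leaves room for this. The triple is a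
  union of cubes of the generation of \<open>d\<close>, all of the same volume.\<close>

lemma A1_weight_decay_triple:
  fixes d :: "int \<times> (int ^ 'n)"
  assumes "A1_weight u" and U: "A1_const u = ennreal U" and E: "E \<in> sets lebesgue" "E \<subseteq> triple d"
    and small: "emeasure lebesgue E < ennreal ((1 / 2 ^ Suc CARD('n)) ^ m) * emeasure lebesgue (dyadic d)"
  shows "emeasure (weighted u) E \<le> ennreal ((1 - 1 / (2 * U)) ^ m) * emeasure (weighted u) (triple d)"
proof -
  let ?c = "ennreal ((1 / 2 ^ Suc CARD('n)) ^ m) * emeasure lebesgue (dyadic d)"
  obtain T where T: "open T" "E \<subseteq> T" "emeasure lebesgue T \<le> ?c"
  proof -
    have "emeasure lebesgue E < top" by (rule order_less_le_trans[OF small]) simp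
    then obtain a where a: "emeasure lebesgue E = ennreal a" "0 \<le> a" by (cases "emeasure lebesgue E") auto
    define b :: real where "b = (1 / 2 ^ Suc CARD('n)) ^ m * (2 powi fst d) ^ CARD('n)"
    have b: "?c = ennreal b" "0 \<le> b"
      unfolding b_def emeasure_dyadic by (rule ennreal_mult''[symmetric]; simp) simp
    have "a < b" using small unfolding a b using a by (simp add: ennreal_less_iff)
    then obtain T where T: "open T" "E \<subseteq> T" "T - E \<in> lmeasurable" "emeasure lebesgue (T - E) < ennreal (b - a)"
      using sets_lebesgue_outer_open[OF E(1), of "b - a"] by auto
    have "emeasure lebesgue T = emeasure lebesgue E + emeasure lebesgue (T - E)"
      using T E(1) by (subst plus_emeasure) (auto simp: fmeasurable_def Un_absorb1 intro!: arg_cong2[where f=emeasure])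
    also have "\<dots> \<le> ennreal a + ennreal (b - a)" using T(4) a by (intro add_mono) auto
    also have "\<dots> = ?c" using \<open>a < b\<close> a b by (simp flip: ennreal_plus)
    finally show ?thesis using T that by blast
  qed
  let ?G = "T \<inter> triple d"
  have "emeasure (weighted u) E \<le> emeasure (weighted u) ?G"
    using T E by (intro emeasure_mono) auto
  also have "\<dots> \<le> ennreal ((1 - 1 / (2 * U)) ^ m) * emeasure (weighted u) (triple d)"
  proof (rule A1_weight_decay_dyadic_open[OF assms(1) U, where s = "fst d"])
    show "?G \<in> sets lebesgue" using T by auto
    show "dyadic_open ?G"
    proof (rule dyadic_open_Int[OF open_imp_dyadic_open[OF T(1)]])
      show "dyadic_open (triple d)"
        unfolding dyadic_open_def using triple_saturated mem_dyadic_index by blast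
    qed
    fix z
    have "emeasure lebesgue (?G \<inter> dyadic (fst d, z)) \<le> emeasure lebesgue T"
      using T by (intro emeasure_mono) auto
    also have "\<dots> \<le> ?c" by fact
    also have "emeasure lebesgue (dyadic d) = emeasure lebesgue (dyadic (fst d, z))"
      by (simp add: emeasure_dyadic)
    finally show "emeasure lebesgue (?G \<inter> dyadic (fst d, z)) \<le>
      ennreal ((1 / 2 ^ Suc CARD('n)) ^ m) * emeasure lebesgue (dyadic (fst d, z))" .
  qed (simp_all add: triple_saturated)
  finally show ?thesis .
qed

section \<open>Principal cubes\<close>

lemma sum_powi_le:
  fixes K :: "int set"
  assumes "finite K" "\<forall>k\<in>K. k \<le> M"
  shows "(\<Sum>k\<in>K. 2 powi k) \<le> (2 * 2 powi M :: real)"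
  using assms
proof (induction K arbitrary: M rule: finite_linorder_max_induct)
  case empty
  then show ?case by simp
next
  case (insert b A)
  have "(\<Sum>k\<in>A. 2 powi k) \<le> (2 * 2 powi (b - 1) :: real)"
    using insert.hyps(2) by (intro insert.IH) auto
  also have "\<dots> = 2 powi b" by (simp add: power_int_diff)
  finally have "(\<Sum>k\<in>insert b A. 2 powi k) \<le> (2 * 2 powi b :: real)"
    using insert.hyps by (subst sum.insert) auto
  also have "\<dots> \<le> 2 * 2 powi M"
    using insert.prems by (intro mult_left_mono power_int_increasing) auto
  finally show ?case .
qed

text \<open>Distinct exponents make the sum geometric, hence at most twice its largest term. It is
  applied pointwise, to the cubes through a fixed point.\<close>

lemma sum_inj_powi_le:
  fixes \<kappa> :: "'a \<Rightarrow> int" and y :: ennreal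
  assumes "finite S" "inj_on \<kappa> S" and le: "\<And>d. d \<in> S \<Longrightarrow> ennreal (2 powi \<kappa> d) \<le> y"
  shows "(\<Sum>d\<in>S. ennreal (2 powi \<kappa> d)) \<le> 2 * y"
proof (cases "S = {}")
  case False
  define M where "M = Max (\<kappa> ` S)"
  have "M \<in> \<kappa> ` S" unfolding M_def using assms False by (intro Max_in) auto
  then have M: "ennreal (2 powi M) \<le> y" using le by blast
  have "(\<Sum>d\<in>S. 2 powi \<kappa> d) = (\<Sum>k\<in>\<kappa> ` S. 2 powi k :: real)"
    by (simp add: sum.reindex[OF assms(2)])
  also have "\<dots> \<le> 2 * 2 powi M"
    using assms by (intro sum_powi_le) (auto simp: M_def)
  finally have "(\<Sum>d\<in>S. ennreal (2 powi \<kappa> d)) \<le> ennreal (2 * 2 powi M)"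
    by (subst sum_ennreal) (auto intro: ennreal_leI)
  also have "\<dots> = 2 * ennreal (2 powi M)" by (simp add: ennreal_mult)
  also have "\<dots> \<le> 2 * y" using M by (intro mult_left_mono) auto
  finally show ?thesis .
qed simp

text \<open>Averages over triples are rounded down to powers of two. A strict inequality between
  levels is then a factor of at least 2 between rounded averages, which turns increasing averages
  into geometric sums.\<close>

definition level :: "(real ^ 'n \<Rightarrow> real) \<Rightarrow> int \<times> (int ^ 'n) \<Rightarrow> int" where
  "level w d = \<lfloor>log 2 (measure (weighted w) (triple d) / measure lebesgue (triple d))\<rfloor>"

lemma triple_finite: "emeasure lebesgue (triple d) < top"
  and triple_pos: "0 < emeasure lebesgue (triple d)"
  by (simp_all add: triple_halfopen emeasure_halfopen)

lemma weight_triple_finite: "weight w \<Longrightarrow> emeasure (weighted w) (triple d) < top"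
  unfolding triple_halfopen by (rule weight_halfopen_finite)

lemma floor_log_powi:
  fixes y :: real
  assumes "0 < y"
  shows "2 powi \<lfloor>log 2 y\<rfloor> \<le> y" "y < 2 powi (\<lfloor>log 2 y\<rfloor> + 1)"
proof -
  have "of_int \<lfloor>log 2 y\<rfloor> \<le> log 2 y" "log 2 y < of_int (\<lfloor>log 2 y\<rfloor> + 1)" by linarith+
  then have "2 powr of_int \<lfloor>log 2 y\<rfloor> \<le> y" "y < 2 powr of_int (\<lfloor>log 2 y\<rfloor> + 1)"
    using assms by (simp_all only: le_log_iff log_less_iff one_less_numeral_iff semiring_norm)
  then show "2 powi \<lfloor>log 2 y\<rfloor> \<le> y" "y < 2 powi (\<lfloor>log 2 y\<rfloor> + 1)"
    by (simp_all add: powr_real_of_int' del: of_int_add)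
qed

lemma level_bounds:
  assumes w: "weight w"
  shows "ennreal (2 powi level w d) * emeasure lebesgue (triple d) \<le> emeasure (weighted w) (triple d)"
    and "emeasure (weighted w) (triple d) \<le> ennreal (2 powi (level w d + 1)) * emeasure lebesgue (triple d)"
proof -
  let ?T = "triple d"
  define x where "x = measure (weighted w) ?T"
  define q where "q = measure lebesgue ?T"
  have x: "emeasure (weighted w) ?T = ennreal x"
    unfolding x_def using weight_triple_finite[OF w, of d] by (intro emeasure_eq_ennreal_measure) simp
  have q: "emeasure lebesgue ?T = ennreal q"
    unfolding q_def using triple_finite[of d] by (intro emeasure_eq_ennreal_measure) (simp del: emeasure_completion)
  have q0: "0 < q" using triple_pos[of d] unfolding q by simp
  have "0 < emeasure (weighted w) ?T" by (rule weight_emeasure_pos[OF w triple_measurable triple_pos])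
  then have x0: "0 < x" unfolding x by simp
  have "2 powi level w d * q \<le> x" "x \<le> 2 powi (level w d + 1) * q"
    using floor_log_powi[of "x / q"] x0 q0
    unfolding level_def x_def[symmetric] q_def[symmetric]
    by (simp_all add: pos_le_divide_eq pos_divide_less_eq)
  then show "ennreal (2 powi level w d) * emeasure lebesgue (triple d) \<le> emeasure (weighted w) (triple d)"
    and "emeasure (weighted w) (triple d) \<le> ennreal (2 powi (level w d + 1)) * emeasure lebesgue (triple d)"
    unfolding x q using q0 by (simp_all only: ennreal_mult''[OF less_imp_le[OF q0], symmetric] ennreal_leI)
qed

text \<open>The triple itself competes in the maximal function. \<open>X\<close> is a larger triple
  when the Fujii--Wilson constant is the target, and the whole space when \<open>Mu\<close>
  is.\<close>

lemma level_le_maximal: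
  assumes w: "weight (w :: real ^ 'n \<Rightarrow> real)" and x: "x \<in> triple d" "triple d \<subseteq> X"
  shows "ennreal (2 powi level w d) \<le> maximal (\<lambda>y. w y * indicator X y) x"
proof -
  have "ennreal (2 powi level w d) * emeasure lebesgue (triple d) \<le> emeasure (weighted w) (triple d)"
    by (rule level_bounds[OF w])
  also have "\<dots> = (\<integral>\<^sup>+y\<in>triple d. ennreal \<bar>w y * indicator X y\<bar> \<partial>lebesgue)"
    unfolding emeasure_weighted[OF weight_measurable[OF w] triple_measurable] using weight_nonneg[OF w] x(2)
    by (intro nn_integral_cong) (auto split: split_indicator)
  also have "\<dots> \<le> maximal (\<lambda>y. w y * indicator X y) x * emeasure lebesgue (triple d)"
    using avg_le_maximal[of "3 * 2 powi fst d" x _ "\<lambda>y. w y * indicator X y"] x(1)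
    unfolding triple_halfopen by (subst emeasure_halfopen) simp_all
  finally have "emeasure lebesgue (triple d) * ennreal (2 powi level w d)
      \<le> emeasure lebesgue (triple d) * maximal (\<lambda>y. w y * indicator X y) x"
    by (simp only: mult.commute)
  then show ?thesis
    using triple_finite[of d] triple_pos[of d]
    by (subst (asm) ennreal_mult_le_mult_iff) (auto simp del: emeasure_completion)
qed

lemma sum_mult_indicator_filter:
  fixes f :: "'a \<Rightarrow> ennreal"
  assumes "finite D"
  shows "(\<Sum>d\<in>D. f d * indicator (A d) x) = (\<Sum>d\<in>{d\<in>D. x \<in> A d}. f d)"
  unfolding sum.inter_filter[OF assms] by (intro sum.cong) (auto split: split_indicator)

text \<open>By \<open>disj\<close> the cubes through a point have distinct levels, so the sum there
  is at most twice the maximal function of \<open>v\<close> localised to \<open>triple P\<close>,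
  whose integral the Fujii--Wilson constant controls.\<close>

lemma sum_level_below:
  fixes v :: "real ^ 'n \<Rightarrow> real"
  assumes v: "weight v" and "finite D"
    and disj: "\<And>d e. d \<in> D \<Longrightarrow> e \<in> D \<Longrightarrow> level v d = level v e \<Longrightarrow> dyadic d \<inter> dyadic e \<noteq> {} \<Longrightarrow> d = e"
    and sub: "\<And>d. d \<in> D \<Longrightarrow> dyadic d \<subseteq> dyadic P" "\<And>d. d \<in> D \<Longrightarrow> triple d \<subseteq> triple P"
  shows "(\<Sum>d\<in>D. ennreal (2 powi level v d) * emeasure lebesgue (dyadic d))
    \<le> 2 * (Ainf_const v * emeasure (weighted v) (triple P))"
proof -
  let ?Mv = "maximal (\<lambda>y. v y * indicator (triple P) y)"
  have "(\<Sum>d\<in>D. ennreal (2 powi level v d) * emeasure lebesgue (dyadic d))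
      = (\<Sum>d\<in>D. \<integral>\<^sup>+x. ennreal (2 powi level v d) * indicator (dyadic d) x \<partial>lebesgue)"
    by (simp add: nn_integral_cmult_indicator del: emeasure_completion)
  also have "\<dots> = (\<integral>\<^sup>+x. (\<Sum>d\<in>D. ennreal (2 powi level v d) * indicator (dyadic d) x) \<partial>lebesgue)"
    by (intro nn_integral_sum[symmetric]) measurable
  also have "\<dots> \<le> (\<integral>\<^sup>+x\<in>triple P. ?Mv x \<partial>lebesgue) * 2"
  \<comment> \<open>The factor 2 is moved to the finite sum, which is measurable; taking it out on
    the other side would call for measurability of the maximal function.\<close>
  proof (rule le_mult_of_divide_le_ennreal)
    have "(\<integral>\<^sup>+x. (\<Sum>d\<in>D. ennreal (2 powi level v d) * indicator (dyadic d) x) \<partial>lebesgue) / 2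
        = (\<integral>\<^sup>+x. (\<Sum>d\<in>D. ennreal (2 powi level v d) * indicator (dyadic d) x) / 2 \<partial>lebesgue)"
      by (intro nn_integral_divide[symmetric]) measurable
    also have "\<dots> \<le> (\<integral>\<^sup>+x\<in>triple P. ?Mv x \<partial>lebesgue)"
  proof (intro nn_integral_mono divide_le_posI_ennreal)
    fix x
    define S where "S = {d\<in>D. x \<in> dyadic d}"
    have "(\<Sum>d\<in>D. ennreal (2 powi level v d) * indicator (dyadic d) x) = (\<Sum>d\<in>S. ennreal (2 powi level v d))"
      unfolding S_def by (rule sum_mult_indicator_filter[OF assms(2)])
    also have "\<dots> \<le> 2 * (?Mv x * indicator (triple P) x)"
    proof (cases "S = {}")
      case False
      then have "x \<in> triple P" using sub dyadic_subset_triple unfolding S_def by blast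
      moreover have "(\<Sum>d\<in>S. ennreal (2 powi level v d)) \<le> 2 * ?Mv x"
      proof (rule sum_inj_powi_le)
        show "finite S" using assms(2) by (simp add: S_def)
        show "inj_on (level v) S" using disj unfolding S_def inj_on_def by blast
        show "ennreal (2 powi level v d) \<le> ?Mv x" if "d \<in> S" for d
          using that dyadic_subset_triple[of d] sub[of d] unfolding S_def by (intro level_le_maximal[OF v]) auto
      qed
      ultimately show ?thesis by simp
    qed simp
    finally show "(\<Sum>d\<in>D. ennreal (2 powi level v d) * indicator (dyadic d) x) \<le> 2 * (?Mv x * indicator (triple P) x)" .
  qed simp
    finally show "(\<integral>\<^sup>+x. (\<Sum>d\<in>D. ennreal (2 powi level v d) * indicator (dyadic d) x) \<partial>lebesgue) / 2
        \<le> (\<integral>\<^sup>+x\<in>triple P. ?Mv x \<partial>lebesgue)" .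
  qed simp_all
  also have "\<dots> \<le> 2 * (Ainf_const v * emeasure (weighted v) (triple P))"
    unfolding mult.commute[of _ 2] triple_halfopen by (intro mult_left_mono Ainf_halfopen[OF v]) simp_all
  finally show ?thesis .
qed

text \<open>The cubes are grouped under principal ones: those all of whose larger ancestors carry a
  strictly smaller average of \<open>u\<close>. Inside each group the average of \<open>u\<close> is controlled by that
  of the principal cube, and the principal averages at a point add up to a multiple of \<open>Mu\<close>.\<close>

lemma sum_level_class:
  fixes u v :: "real ^ 'n \<Rightarrow> real"
  assumes u: "A1_weight u" and v: "weight v" and h [measurable]: "h \<in> borel_measurable lebesgue"
    and "finite D"
    and disj: "\<And>d e. d \<in> D \<Longrightarrow> e \<in> D \<Longrightarrow> level v d = level v e \<Longrightarrow> dyadic d \<inter> dyadic e \<noteq> {} \<Longrightarrow> d = e"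
    and avg: "\<And>d. d \<in> D \<Longrightarrow> ennreal (2 powi (level v d - l)) * emeasure lebesgue (dyadic d) \<le> (\<integral>\<^sup>+x\<in>dyadic d. h x \<partial>lebesgue)"
  shows "(\<Sum>d\<in>D. ennreal (2 powi (level v d - l)) * emeasure (weighted u) (triple d))
    \<le> ennreal (16 * 9 ^ CARD('n)) * A1_const u * Ainf_const v * (\<integral>\<^sup>+x. h x * ennreal (u x) \<partial>lebesgue)"
proof -
  note wu = A1_weightD[OF u]
  note [measurable] = weight_measurable[OF wu]
  let ?p = "\<lambda>k::int. ennreal (2 powi k)"
  have p_add: "?p (a + b) = ?p a * ?p b" for a b
    by (simp add: power_int_add ennreal_mult)
  define N :: ennreal where "N = ennreal (3 ^ CARD('n))"
  have T: "emeasure lebesgue (triple d) = N * emeasure lebesgue (dyadic d)" for d :: "int \<times> (int ^ 'n)"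
    unfolding N_def by (rule emeasure_triple)
  define R where "R = {P\<in>D. \<forall>e\<in>D. dyadic P \<subseteq> dyadic e \<longrightarrow> fst P < fst e \<longrightarrow> level u e < level u P}"
  define B where "B P = {d\<in>D. dyadic d \<subseteq> dyadic P \<and> triple d \<subseteq> triple P \<and> level u d \<le> level u P}" for P
  have finR: "finite R" using \<open>finite D\<close> by (simp add: R_def)
  have finB: "finite (B P)" for P using \<open>finite D\<close> by (simp add: B_def)
  have ne: "dyadic d \<noteq> {}" for d :: "int \<times> (int ^ 'n)"
    using emeasure_dyadic_pos[of d] by (metis emeasure_empty less_irrefl)
  have principal: "\<exists>P\<in>R. d \<in> B P" if d: "d \<in> D" for d
  proof -
    \<comment> \<open>The largest candidate above \<open>d\<close> is principal: a still larger cube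
      of at least the same level would again be a candidate.\<close>
    define E where "E = {e\<in>D. dyadic d \<subseteq> dyadic e \<and> triple d \<subseteq> triple e \<and> level u d \<le> level u e}"
    have E: "finite E" "d \<in> E" using \<open>finite D\<close> d by (auto simp: E_def)
    have "Max (fst ` E) \<in> fst ` E" using E by (intro Max_in) auto
    then obtain P where "P \<in> E" "fst P = Max (fst ` E)" by (metis imageE)
    then have P: "P \<in> E" "\<And>e. e \<in> E \<Longrightarrow> fst e \<le> fst P"
      using E by simp_all
    have "level u e < level u P" if e: "e \<in> D" "dyadic P \<subseteq> dyadic e" "fst P < fst e" for e
    proof (rule ccontr)
      assume "\<not> ?thesis"
      moreover have "triple P \<subseteq> triple e"
        using triple_nested[of P e] ne[of P] e by (meson all_not_in_conv less_imp_le subsetD)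
      ultimately have "e \<in> E" using P(1) e unfolding E_def by auto
      then show False using P(2) e(3) by fastforce
    qed
    then have "P \<in> R" "d \<in> B P" using P(1) d by (auto simp: E_def R_def B_def)
    then show ?thesis by blast
  qed
  \<comment> \<open>In \<open>8 * N * N\<close> one factor 2 comes from rounding the averages of
    \<open>u\<close>, one from rounding those of \<open>v\<close> and one from the geometric sum;
    each \<open>N\<close> converts the volume of a triple into that of its cube.\<close>
  have group: "(\<Sum>d\<in>B P. ?p (level v d - l) * emeasure (weighted u) (triple d))
      \<le> 8 * N * N * Ainf_const v * (?p (level u P) * (\<integral>\<^sup>+x\<in>dyadic P. h x \<partial>lebesgue))" if P: "P \<in> R" for P
  proof -
    have PD: "P \<in> D" using P by (simp add: R_def)
    have "(\<Sum>d\<in>B P. ?p (level v d - l) * emeasure (weighted u) (triple d))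
      \<le> (\<Sum>d\<in>B P. ?p (level v d - l) * (?p (level u P + 1) * (N * emeasure lebesgue (dyadic d))))"
    proof (intro sum_mono mult_left_mono)
      fix d assume "d \<in> B P"
      then have "(2::real) powi (level u d + 1) \<le> 2 powi (level u P + 1)"
        by (intro power_int_increasing) (auto simp: B_def)
      then show "emeasure (weighted u) (triple d) \<le> ?p (level u P + 1) * (N * emeasure lebesgue (dyadic d))"
        unfolding T[symmetric] by (intro order_trans[OF level_bounds(2)[OF wu]] mult_right_mono ennreal_leI) auto
    qed simp
    also have "\<dots> = ?p (- l) * ?p (level u P + 1) * N * (\<Sum>d\<in>B P. ?p (level v d) * emeasure lebesgue (dyadic d))"
      unfolding sum_distrib_left using p_add[of _ "- l"] by (intro sum.cong) (simp_all add: mult_ac del: emeasure_completion)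
    also have "\<dots> \<le> ?p (- l) * ?p (level u P + 1) * N * (2 * (Ainf_const v * emeasure (weighted v) (triple P)))"
      using disj finB by (intro mult_left_mono sum_level_below[OF v]) (auto simp: B_def)
    also have "\<dots> \<le> ?p (- l) * ?p (level u P + 1) * N * (2 * (Ainf_const v * (?p (level v P + 1) * (N * emeasure lebesgue (dyadic P)))))"
      unfolding T[symmetric] by (intro mult_left_mono level_bounds(2)[OF v]) auto
    also have "\<dots> = 8 * N * N * Ainf_const v * (?p (level u P) * (?p (level v P - l) * emeasure lebesgue (dyadic P)))"
    proof -
      have 1: "?p (level v P - l) = ?p (level v P) * ?p (- l)" using p_add[of "level v P" "- l"] by simp
      have 8: "(8::ennreal) = 2 * 2 * 2" by simp
      have 2: "?p (a + 1) = ?p a * 2" for a using p_add[of a 1] by simp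
      show ?thesis unfolding 1 2 8 by (simp only: mult_ac)
    qed
    also have "\<dots> \<le> 8 * N * N * Ainf_const v * (?p (level u P) * (\<integral>\<^sup>+x\<in>dyadic P. h x \<partial>lebesgue))"
      by (intro mult_left_mono avg PD) auto
    finally show ?thesis .
  qed
  have "(\<Sum>P\<in>R. ?p (level u P) * (\<integral>\<^sup>+x\<in>dyadic P. h x \<partial>lebesgue))
      = (\<Sum>P\<in>R. \<integral>\<^sup>+x. h x * (?p (level u P) * indicator (dyadic P) x) \<partial>lebesgue)"
    by (simp add: nn_integral_cmult[symmetric] mult_ac)
  also have "\<dots> = (\<integral>\<^sup>+x. (\<Sum>P\<in>R. h x * (?p (level u P) * indicator (dyadic P) x)) \<partial>lebesgue)"
    by (intro nn_integral_sum[symmetric]) measurable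
  also have "\<dots> \<le> (\<integral>\<^sup>+x. 2 * A1_const u * (h x * ennreal (u x)) \<partial>lebesgue)"
  proof (rule nn_integral_mono_AE)
    show "AE x in lebesgue. (\<Sum>P\<in>R. h x * (?p (level u P) * indicator (dyadic P) x)) \<le> 2 * A1_const u * (h x * ennreal (u x))"
      using A1_weight_AE_maximal_le[OF u]
    proof eventually_elim
      case (elim x)
      define S where "S = {P\<in>R. x \<in> dyadic P}"
      have "(\<Sum>P\<in>R. ?p (level u P) * indicator (dyadic P) x) = (\<Sum>P\<in>S. ?p (level u P))"
        unfolding S_def by (rule sum_mult_indicator_filter[OF finR])
      also have "\<dots> \<le> 2 * maximal u x"
      proof (rule sum_inj_powi_le)
        show "finite S" using finR by (simp add: S_def)
        \<comment> \<open>Of two principal cubes through \<open>x\<close> of different size the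
          larger has the strictly smaller level, so equal levels force equal cubes.\<close>
        show "inj_on (level u) S"
        proof (rule inj_onI)
          fix P Q assume PQ: "P \<in> S" "Q \<in> S" "level u P = level u Q"
          then have x: "x \<in> dyadic P" "x \<in> dyadic Q" by (auto simp: S_def)
          have "\<not> fst P < fst Q" using PQ dyadic_nested[of P Q x] x unfolding S_def R_def by fastforce
          moreover have "\<not> fst Q < fst P" using PQ dyadic_nested[of Q P x] x unfolding S_def R_def by fastforce
          ultimately show "P = Q" using dyadic_eqI[of P Q x] x by auto
        qed
        fix P assume "P \<in> S"
        then show "?p (level u P) \<le> maximal u x"
          using level_le_maximal[OF wu, of x P UNIV] dyadic_subset_triple[of P] by (auto simp: S_def)
      qed
      also have "\<dots> \<le> 2 * (A1_const u * ennreal (u x))" using elim by (intro mult_left_mono) auto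
      finally have "h x * (\<Sum>P\<in>R. ?p (level u P) * indicator (dyadic P) x) \<le> h x * (2 * (A1_const u * ennreal (u x)))"
        by (intro mult_left_mono) auto
      then show ?case unfolding sum_distrib_left by (simp add: mult_ac)
    qed
  qed
  also have "\<dots> = 2 * A1_const u * (\<integral>\<^sup>+x. h x * ennreal (u x) \<partial>lebesgue)"
    by (intro nn_integral_cmult) measurable
  finally have main: "(\<Sum>P\<in>R. ?p (level u P) * (\<integral>\<^sup>+x\<in>dyadic P. h x \<partial>lebesgue))
      \<le> 2 * A1_const u * (\<integral>\<^sup>+x. h x * ennreal (u x) \<partial>lebesgue)" .
  let ?f = "\<lambda>d. ?p (level v d - l) * emeasure (weighted u) (triple d)"
  \<comment> \<open>A cube may belong to several groups; counting it in each only enlarges the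
    right-hand side.\<close>
  have "(\<Sum>d\<in>D. ?f d) \<le> (\<Sum>d\<in>D. \<Sum>P\<in>R. if d \<in> B P then ?f d else 0)"
  proof (rule sum_mono)
    fix d assume "d \<in> D"
    then obtain P where P: "P \<in> R" "d \<in> B P" using principal by blast
    then show "?f d \<le> (\<Sum>P\<in>R. if d \<in> B P then ?f d else 0)"
      using member_le_sum[of P R "\<lambda>P. if d \<in> B P then ?f d else 0"] finR by simp
  qed
  also have "\<dots> = (\<Sum>P\<in>R. \<Sum>d\<in>D. if d \<in> B P then ?f d else 0)" by (rule sum.swap)
  also have "\<dots> = (\<Sum>P\<in>R. \<Sum>d\<in>B P. ?f d)"
    using \<open>finite D\<close> by (intro sum.cong refl sum.mono_neutral_cong_right) (auto simp: B_def)
  also have "\<dots> \<le> (\<Sum>P\<in>R. 8 * N * N * Ainf_const v * (?p (level u P) * (\<integral>\<^sup>+x\<in>dyadic P. h x \<partial>lebesgue)))"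
    by (intro sum_mono group)
  also have "\<dots> \<le> 8 * N * N * Ainf_const v * (2 * A1_const u * (\<integral>\<^sup>+x. h x * ennreal (u x) \<partial>lebesgue))"
    unfolding sum_distrib_left[symmetric] by (intro mult_left_mono main) auto
  also have "\<dots> = (8 * 2 * (N * N)) * A1_const u * Ainf_const v * (\<integral>\<^sup>+x. h x * ennreal (u x) \<partial>lebesgue)"
    by (simp only: mult_ac)
  also have "8 * 2 * (N * N) = ennreal (16 * 9 ^ CARD('n))"
  proof -
    have "N * N = ennreal (9 ^ CARD('n))"
      unfolding N_def by (simp flip: ennreal_mult power_mult_distrib)
    then show ?thesis by (simp add: ennreal_mult)
  qed
  finally show ?thesis .
qed

section \<open>Slabs of the second weight\<close>

definition slab :: "(real ^ 'n \<Rightarrow> real) \<Rightarrow> int \<Rightarrow> (real ^ 'n) set" where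
  "slab v k = {x. 2 powi k \<le> v x \<and> v x < 2 powi (k + 1)}"

lemma slab_measurable: "v \<in> borel_measurable lebesgue \<Longrightarrow> slab v k \<in> sets lebesgue"
proof -
  assume [measurable]: "v \<in> borel_measurable lebesgue"
  have "{x \<in> space lebesgue. 2 powi k \<le> v x \<and> v x < 2 powi (k + 1)} \<in> sets lebesgue"
    by measurable
  then show ?thesis by (simp add: slab_def)
qed

text \<open>The share of \<open>u(T)\<close> taken by the part of a tripled cube \<open>T\<close> on which \<open>v\<close> is about
  \<open>2^(-l)\<close> times its average: nothing for large \<open>l\<close> by the \<open>A\<^sub>1\<close> condition on \<open>v\<close>,
  exponentially little for negative \<open>l\<close> by that on \<open>u\<close>. The truncated subtraction makes the
  exponent 0, hence the bound trivial, for the first \<open>2 n + 1\<close> negative values of \<open>l\<close>.\<close>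

definition slab_share :: "nat \<Rightarrow> real \<Rightarrow> real \<Rightarrow> int \<Rightarrow> real" where
  "slab_share n U A l =
    (if 0 \<le> l then (if of_int l \<le> 1 + log 2 A then 1 else 0)
     else (1 - 1 / (2 * U)) ^ ((nat (- l - 1) - (2 * n + 1)) div (n + 1)))"

lemma emeasure_weighted_null:
  fixes E :: "(real ^ 'n) set"
  assumes "w \<in> borel_measurable lebesgue" "E \<in> sets lebesgue" "AE x in lebesgue. x \<notin> E"
  shows "emeasure (weighted w) E = 0"
proof -
  have "(\<integral>\<^sup>+x\<in>E. ennreal (w x) \<partial>lebesgue) = (\<integral>\<^sup>+(x :: real ^ 'n). 0 \<partial>lebesgue)"
    using assms(3) by (intro nn_integral_cong_AE) (auto elim: eventually_mono)
  then show ?thesis using emeasure_weighted[OF assms(1,2)] by simp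
qed

text \<open>The average of \<open>v\<close> over the triple is at least
  \<open>2 powi level v d\<close> and, for almost every point of the triple, at most
  \<open>A\<close> times the value of \<open>v\<close> there, which on the slab is below
  \<open>2^(k+1)\<close>. A slab point outside the null set thus forces
  \<open>level v d - k - 1 < log 2 A\<close>.\<close>

lemma slab_high_null:
  fixes v :: "real ^ 'n \<Rightarrow> real"
  assumes v: "A1_weight v" and A: "A1_const v = ennreal A"
    and l: "1 + log 2 A < of_int (level v d - k)"
  shows "AE x in lebesgue. x \<notin> slab v k \<inter> triple d"
proof -
  note wv = A1_weightD[OF v]
  have A1: "1 \<le> A"
    using A1_const_ge_1[OF v] A by (simp add: ennreal_ge_1)
  have "AE x in lebesgue. x \<in> triple d \<longrightarrow>
      emeasure (weighted v) (triple d) \<le> A1_const v * ennreal (v x) * emeasure lebesgue (triple d)"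
    unfolding triple_halfopen by (rule A1_weight_AE_avg_le[OF v]) simp
  then show ?thesis
  proof eventually_elim
    case (elim x)
    show ?case
    proof
      assume x: "x \<in> slab v k \<inter> triple d"
      have "ennreal (2 powi level v d) * emeasure lebesgue (triple d)
          \<le> A1_const v * ennreal (v x) * emeasure lebesgue (triple d)"
        using level_bounds(1)[OF wv, of d] elim x by (meson IntD2 order_trans)
      then have "emeasure lebesgue (triple d) * ennreal (2 powi level v d)
          \<le> emeasure lebesgue (triple d) * (A1_const v * ennreal (v x))"
        by (simp only: mult_ac)
      then have "ennreal (2 powi level v d) \<le> A1_const v * ennreal (v x)"
        using triple_finite[of d] triple_pos[of d]
        by (subst (asm) ennreal_mult_le_mult_iff) (auto simp del: emeasure_completion)
      then have "2 powi level v d \<le> A * v x"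
        using A1 weight_nonneg[OF wv, of x] unfolding A by (simp flip: ennreal_mult)
      also have "\<dots> < A * 2 powi (k + 1)" using x A1 by (auto simp: slab_def)
      finally have "2 powi (level v d - k - 1) < A"
        by (simp add: power_int_diff power_int_add field_simps)
      then have "2 powr of_int (level v d - k - 1) < A"
        by (simp add: powr_real_of_int' del: of_int_diff)
      then have "of_int (level v d - k - 1) < log 2 A"
        using A1 by (subst less_log_iff) auto
      then show False using l by simp
    qed
  qed
qed

text \<open>For very negative \<open>l\<close> Chebyshev's inequality for \<open>v\<close> shows
  that the slab fills a small part of the triple, and \<open>A1_weight_decay_triple\<close> turns
  this into a small share of the \<open>u\<close>-mass. For large \<open>l\<close> the part is null;
  otherwise the bound is trivial.\<close>

lemma slab_triple_le:
  fixes u v :: "real ^ 'n \<Rightarrow> real"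
  assumes u: "A1_weight u" and v: "A1_weight v"
    and U: "A1_const u = ennreal U" and A: "A1_const v = ennreal A"
  shows "emeasure (weighted u) (slab v k \<inter> triple d)
    \<le> ennreal (slab_share CARD('n) U A (level v d - k)) * emeasure (weighted u) (triple d)"
proof -
  let ?E = "slab v k \<inter> triple d"
  define l where "l = level v d - k"
  note wu = A1_weightD[OF u] and wv = A1_weightD[OF v]
  have E: "?E \<in> sets lebesgue"
    by (intro sets.Int slab_measurable weight_measurable wv triple_measurable)
  have mono: "emeasure (weighted u) ?E \<le> emeasure (weighted u) (triple d)"
    by (intro emeasure_mono) simp_all
  consider "0 \<le> l" "of_int l \<le> 1 + log 2 A" | "0 \<le> l" "1 + log 2 A < of_int l"
    | "l < 0" "nat (- l - 1) < 2 * CARD('n) + 1" | "l < 0" "2 * CARD('n) + 1 \<le> nat (- l - 1)"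
    by (meson not_le)
  then show ?thesis unfolding l_def[symmetric]
  proof cases
    case 2
    have "AE x in lebesgue. x \<notin> ?E"
      by (rule slab_high_null[OF v A]) (use 2 in \<open>simp add: l_def\<close>)
    then have "emeasure (weighted u) ?E = 0"
      by (intro emeasure_weighted_null[OF weight_measurable[OF wu] E])
    then show "emeasure (weighted u) ?E \<le> ennreal (slab_share CARD('n) U A l) * emeasure (weighted u) (triple d)"
      by simp
  next
    case 4
    \<comment> \<open>The volume of \<open>?E\<close> is at most \<open>2^(-j) * 3^n\<close> times
      that of the dyadic cube. Of the \<open>j\<close> halvings \<open>2 n + 1\<close> absorb
      \<open>3^n\<close> with strict inequality, and each further block of \<open>n + 1\<close>
      gives one step of the decay.\<close>
    define j where "j = nat (- l - 1)"
    define m where "m = (j - (2 * CARD('n) + 1)) div (CARD('n) + 1)"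
    have "ennreal (2 powi k) * emeasure lebesgue ?E = (\<integral>\<^sup>+x. ennreal (2 powi k) * indicator ?E x \<partial>lebesgue)"
      using E by (simp add: nn_integral_cmult_indicator)
    also have "\<dots> \<le> (\<integral>\<^sup>+x\<in>triple d. ennreal (v x) \<partial>lebesgue)"
      by (intro nn_integral_mono) (auto simp: slab_def intro: ennreal_leI split: split_indicator)
    also have "\<dots> = emeasure (weighted v) (triple d)"
      by (rule emeasure_weighted[OF weight_measurable[OF wv], symmetric]) simp
    also have "\<dots> \<le> ennreal (2 powi (level v d + 1)) * emeasure lebesgue (triple d)"
      by (rule level_bounds[OF wv])
    also have "\<dots> = ennreal (2 powi k) * (ennreal ((1/2) ^ j * 3 ^ CARD('n)) * emeasure lebesgue (dyadic d))"
    proof -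
      have "2 powi (level v d + 1) = 2 powi k * (2 powi (- int j) :: real)"
        using 4 by (subst power_int_add[symmetric]) (simp_all add: l_def j_def add.commute)
      also have "2 powi (- int j) = (1/2 :: real) ^ j"
        by (simp add: power_int_minus field_simps)
      finally have "ennreal (2 powi (level v d + 1)) = ennreal (2 powi k) * ennreal ((1/2) ^ j)"
        by (simp add: ennreal_mult)
      then show ?thesis
        by (simp add: emeasure_triple ennreal_mult mult.assoc del: emeasure_completion)
    qed
    finally have "emeasure lebesgue ?E \<le> ennreal ((1/2) ^ j * 3 ^ CARD('n)) * emeasure lebesgue (dyadic d)"
      by (subst (asm) ennreal_mult_le_mult_iff) (simp_all del: emeasure_completion)
    also have "\<dots> < ennreal ((1 / 2 ^ Suc CARD('n)) ^ m) * emeasure lebesgue (dyadic d)"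
    proof -
      have "Suc CARD('n) * m \<le> j - (2 * CARD('n) + 1)" unfolding m_def Suc_eq_plus1 by (rule times_div_less_eq_dividend)
      then have "(1/2 :: real) ^ (j - (2 * CARD('n) + 1)) \<le> (1/2) ^ (Suc CARD('n) * m)"
        by (intro power_decreasing) auto
      also have "\<dots> = (1 / 2 ^ Suc CARD('n)) ^ m" by (simp only: power_mult power_one_over)
      finally have 1: "(1/2 :: real) ^ (j - (2 * CARD('n) + 1)) \<le> (1 / 2 ^ Suc CARD('n)) ^ m" .
      have "(3::real) ^ CARD('n) \<le> 4 ^ CARD('n)" by (intro power_mono) auto
      also have "\<dots> < 2 ^ (2 * CARD('n) + 1)" by (simp add: power_mult)
      finally have "(1/2) ^ j * (3::real) ^ CARD('n) < (1/2) ^ j * 2 ^ (2 * CARD('n) + 1)" by simp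
      also have "\<dots> = (1/2) ^ (j - (2 * CARD('n) + 1))"
        using 4 by (simp add: power_diff j_def power_one_over)
      finally show ?thesis
        using 1 unfolding emeasure_dyadic
        by (subst (1 2) ennreal_mult''[symmetric]) (auto simp: ennreal_less_iff)
    qed
    finally have "emeasure lebesgue ?E < ennreal ((1 / 2 ^ Suc CARD('n)) ^ m) * emeasure lebesgue (dyadic d)" .
    from A1_weight_decay_triple[OF u U E _ this]
    show "emeasure (weighted u) ?E \<le> ennreal (slab_share CARD('n) U A l) * emeasure (weighted u) (triple d)"
      using 4 by (simp add: slab_share_def m_def j_def)
  qed (use mono in \<open>simp_all add: slab_share_def\<close>)
qed

section \<open>Summation over the levels\<close>

lemma sum_lessThan_add:
  fixes f :: "nat \<Rightarrow> 'a :: comm_monoid_add"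
  shows "sum f {..<a + b} = sum f {..<a} + (\<Sum>i<b. f (a + i))"
  by (induction b) (simp_all add: add.assoc)

text \<open>At most \<open>2 + log 2 A\<close> nonnegative \<open>l\<close> contribute, each 1. The
  first \<open>2 n + 1\<close> negative ones contribute at most 1 each, and the others form
  \<open>n + 1\<close> copies of a geometric series with ratio \<open>1 - 1 / (2 U)\<close> and sum
  \<open>2 U\<close>.\<close>

lemma sum_slab_share_le:
  assumes "finite L" "1 \<le> U" "1 \<le> A"
  shows "(\<Sum>l\<in>L. slab_share n U A l) \<le> (2 * real n + 3 + log 2 A) + (real n + 1) * (2 * U)"
proof -
  define \<eta> where "\<eta> = 1 - 1 / (2 * U)"
  have \<eta>: "0 \<le> \<eta>" "\<eta> \<le> 1" "1 - \<eta> = 1 / (2 * U)" using assms by (auto simp: \<eta>_def field_simps)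
  define g where "g j = \<eta> ^ ((j - (2 * n + 1)) div (n + 1))" for j
  have g: "0 \<le> g j" "g j \<le> 1" for j using \<eta> by (auto simp: g_def power_le_one)
  have "(\<Sum>l\<in>{l\<in>L. 0 \<le> l}. slab_share n U A l) \<le> (\<Sum>l\<in>{0..\<lfloor>1 + log 2 A\<rfloor>}. 1)"
  proof -
    have "(\<Sum>l\<in>{l\<in>L. 0 \<le> l}. slab_share n U A l) = (\<Sum>l\<in>{l\<in>L. 0 \<le> l \<and> of_int l \<le> 1 + log 2 A}. 1)"
      using assms(1) by (intro sum.mono_neutral_cong_right) (auto simp: slab_share_def)
    also have "\<dots> \<le> (\<Sum>l\<in>{0..\<lfloor>1 + log 2 A\<rfloor>}. 1)"
      by (intro sum_mono2) (auto, linarith)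
    finally show ?thesis .
  qed
  also have "\<dots> \<le> 2 + log 2 A"
  proof -
    have "0 \<le> log 2 A" using assms(3) by (simp add: zero_le_log_cancel_iff)
    then have "0 \<le> \<lfloor>1 + log 2 A\<rfloor>" by simp
    then have "(\<Sum>l\<in>{0..\<lfloor>1 + log 2 A\<rfloor>}. 1 :: real) = of_int (\<lfloor>1 + log 2 A\<rfloor> + 1)" by simp
    then show ?thesis by linarith
  qed
  finally have nonneg: "(\<Sum>l\<in>{l\<in>L. 0 \<le> l}. slab_share n U A l) \<le> 2 + log 2 A" .
  have "(\<Sum>l\<in>{l\<in>L. \<not> 0 \<le> l}. slab_share n U A l) = (\<Sum>j\<in>(\<lambda>l. nat (- l - 1)) ` {l\<in>L. \<not> 0 \<le> l}. g j)"
    by (subst sum.reindex) (auto simp: inj_on_def slab_share_def g_def \<eta>_def intro!: sum.cong)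
  also obtain K where "(\<lambda>l. nat (- l - 1)) ` {l\<in>L. \<not> 0 \<le> l} \<subseteq> {..<K}"
    using finite_nat_iff_bounded[of "(\<lambda>l. nat (- l - 1)) ` {l\<in>L. \<not> 0 \<le> l}"] assms(1) by auto
  then have "sum g ((\<lambda>l. nat (- l - 1)) ` {l\<in>L. \<not> 0 \<le> l}) \<le> (\<Sum>j<(2 * n + 1) + K * (n + 1). g j)"
    using g by (intro sum_mono2) auto
  also have "\<dots> \<le> (2 * real n + 1) + (real n + 1) * (2 * U)"
  proof -
    \<comment> \<open>The exponent is an integer quotient by \<open>n + 1\<close>, so it is constant
      on blocks of \<open>n + 1\<close> consecutive indices.\<close>
    have "(\<Sum>i<K * (n + 1). g ((2 * n + 1) + i)) = (\<Sum>m<K. \<Sum>i=m * (n + 1)..<m * (n + 1) + (n + 1). g ((2 * n + 1) + i))"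
      by (rule sum.nat_group[symmetric])
    also have "\<dots> = (\<Sum>m<K. (real n + 1) * \<eta> ^ m)"
    proof (rule sum.cong)
      fix m
      have "(\<Sum>i=m * (n + 1)..<m * (n + 1) + (n + 1). g ((2 * n + 1) + i)) = (\<Sum>i=m * (n + 1)..<m * (n + 1) + (n + 1). \<eta> ^ m)"
      proof (rule sum.cong)
        fix i assume "i \<in> {m * (n + 1)..<m * (n + 1) + (n + 1)}"
        then have "i div (n + 1) = m" by (intro div_nat_eqI) (auto simp: mult.commute)
        then show "g ((2 * n + 1) + i) = \<eta> ^ m" by (simp add: g_def)
      qed simp
      then show "(\<Sum>i=m * (n + 1)..<m * (n + 1) + (n + 1). g ((2 * n + 1) + i)) = (real n + 1) * \<eta> ^ m" by simp
    qed simp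
    also have "\<dots> = (real n + 1) * (\<Sum>m<K. \<eta> ^ m)" by (simp add: sum_distrib_left)
    also have "\<dots> \<le> (real n + 1) * (2 * U)"
    proof (intro mult_left_mono)
      have "1 - \<eta> ^ K = 1 / (2 * U) * (\<Sum>m<K. \<eta> ^ m)" using one_diff_power_eq[of \<eta> K] \<eta>(3) by simp
      then have "1 / (2 * U) * (\<Sum>m<K. \<eta> ^ m) \<le> 1" using \<eta>(1) by (smt (verit) zero_le_power)
      then show "(\<Sum>m<K. \<eta> ^ m) \<le> 2 * U" using assms(2) by (simp add: field_simps)
    qed simp
    finally have "(\<Sum>i<K * (n + 1). g ((2 * n + 1) + i)) \<le> (real n + 1) * (2 * U)" .
    moreover have "(\<Sum>j<2 * n + 1. g j) \<le> (\<Sum>j<2 * n + 1. 1)" using g by (intro sum_mono) auto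
    ultimately show ?thesis unfolding sum_lessThan_add[of g "2 * n + 1"] by simp
  qed
  finally have neg: "(\<Sum>l\<in>{l\<in>L. \<not> 0 \<le> l}. slab_share n U A l) \<le> (2 * real n + 1) + (real n + 1) * (2 * U)" .
  have "(\<Sum>l\<in>L. slab_share n U A l)
      = (\<Sum>l\<in>{l\<in>L. 0 \<le> l}. slab_share n U A l) + (\<Sum>l\<in>{l\<in>L. \<not> 0 \<le> l}. slab_share n U A l)"
    using assms(1) by (subst sum.union_disjoint[symmetric]) (auto intro!: sum.cong)
  then show ?thesis using nonneg neg by simp
qed

text \<open>Continuity from below along an enumeration. It reduces the family of all admissible
  pairs to finite ones, where maximal cubes exist.\<close>

lemma emeasure_UN_le_finite:
  assumes "countable S" and X: "\<And>i. i \<in> S \<Longrightarrow> X i \<in> sets M"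
    and le: "\<And>F. finite F \<Longrightarrow> F \<subseteq> S \<Longrightarrow> emeasure M (\<Union>i\<in>F. X i) \<le> c"
  shows "emeasure M (\<Union>i\<in>S. X i) \<le> c"
proof (cases "S = {}")
  case False
  define F where "F n = from_nat_into S ` {..n}" for n :: nat
  have F: "finite (F n)" "F n \<subseteq> S" for n
    using from_nat_into[OF False] by (auto simp: F_def)
  have "(\<Union>i\<in>S. X i) = (\<Union>n. \<Union>i\<in>F n. X i)"
  proof -
    have "S = (\<Union>n. F n)"
      using range_from_nat_into[OF False assms(1)] unfolding F_def by blast
    then show ?thesis by blast
  qed
  also have "emeasure M \<dots> = (SUP n. emeasure M (\<Union>i\<in>F n. X i))"
  proof (rule SUP_emeasure_incseq[symmetric])
    show "range (\<lambda>n. \<Union>i\<in>F n. X i) \<subseteq> sets M"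
      using F X by (auto intro!: sets.finite_UN)
    show "incseq (\<lambda>n. \<Union>i\<in>F n. X i)"
      by (intro monoI UN_mono) (auto simp: F_def)
  qed
  also have "\<dots> \<le> c" by (intro SUP_least le F)
  finally show ?thesis .
qed simp

section \<open>The product measure on unions of slabs\<close>

lemma weighted_slab_le:
  fixes u v :: "real ^ 'n \<Rightarrow> real"
  assumes u: "weight u" and v: "weight v"
  shows "emeasure (weighted (\<lambda>x. u x * v x)) (slab v k \<inter> triple d)
    \<le> 2 * (ennreal (2 powi k) * emeasure (weighted u) (slab v k \<inter> triple d))"
proof -
  let ?E = "slab v k \<inter> triple d"
  note [measurable] = weight_measurable[OF u] weight_measurable[OF v]
  have [measurable]: "?E \<in> sets lebesgue"
    by (intro sets.Int slab_measurable weight_measurable v triple_measurable)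
  have "emeasure (weighted (\<lambda>x. u x * v x)) ?E = (\<integral>\<^sup>+x\<in>?E. ennreal (u x * v x) \<partial>lebesgue)"
    by (intro emeasure_weighted) measurable
  also have "\<dots> \<le> (\<integral>\<^sup>+x. ennreal (2 powi (k + 1)) * (ennreal (u x) * indicator ?E x) \<partial>lebesgue)"
  proof (intro nn_integral_mono)
    fix x
    have "ennreal (u x * v x) \<le> ennreal (2 powi (k + 1)) * ennreal (u x)" if "x \<in> ?E"
    proof -
      have "u x * v x \<le> 2 powi (k + 1) * u x"
        using that weight_nonneg[OF u, of x] by (subst mult.commute) (auto simp: slab_def intro!: mult_right_mono)
      then show ?thesis using weight_nonneg[OF u, of x] by (simp add: ennreal_leI flip: ennreal_mult)
    qed
    then show "ennreal (u x * v x) * indicator ?E x \<le> ennreal (2 powi (k + 1)) * (ennreal (u x) * indicator ?E x)"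
      by (auto split: split_indicator)
  qed
  also have "\<dots> = ennreal (2 powi (k + 1)) * emeasure (weighted u) ?E"
    by (subst nn_integral_cmult) (simp_all add: emeasure_weighted weight_measurable[OF u])
  also have "ennreal (2 powi (k + 1)) = 2 * ennreal (2 powi k)"
    by (simp add: power_int_add ennreal_mult mult.commute)
  finally show ?thesis by (simp only: mult.assoc)
qed

text \<open>For each \<open>k\<close> only maximal cubes are kept, since their triples contain those
  of the others. Sorting by \<open>lev\<close> makes the slab share constant on each class, so the
  bounds of \<open>sum_level_class\<close> add up with the total share from
  \<open>sum_slab_share_le\<close>.\<close>

lemma weighted_slab_Union_le:
  fixes u v :: "real ^ 'n \<Rightarrow> real"
  assumes u: "A1_weight u" and v: "A1_weight v"
    and U: "A1_const u = ennreal U" and A: "A1_const v = ennreal A"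
    and h [measurable]: "h \<in> borel_measurable lebesgue" and "finite J"
    and avg: "\<And>k d. (k, d) \<in> J \<Longrightarrow> ennreal (2 powi k) * emeasure lebesgue (dyadic d) \<le> (\<integral>\<^sup>+x\<in>dyadic d. h x \<partial>lebesgue)"
  shows "emeasure (weighted (\<lambda>x. u x * v x)) (\<Union>(k, d)\<in>J. slab v k \<inter> triple d)
    \<le> 2 * ennreal ((2 * real CARD('n) + 3 + log 2 A) + (real CARD('n) + 1) * (2 * U)) *
      (ennreal (16 * 9 ^ CARD('n)) * A1_const u * Ainf_const v * (\<integral>\<^sup>+x. h x * ennreal (u x) \<partial>lebesgue))"
proof -
  note wu = A1_weightD[OF u] and wv = A1_weightD[OF v]
  let ?I = "ennreal (16 * 9 ^ CARD('n)) * A1_const u * Ainf_const v * (\<integral>\<^sup>+x. h x * ennreal (u x) \<partial>lebesgue)"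
  let ?s = "slab_share CARD('n) U A"
  have U1: "1 \<le> U" and A1: "1 \<le> A"
    using A1_const_ge_1[OF u] A1_const_ge_1[OF v] U A by (simp_all add: ennreal_ge_1)
  have s0: "0 \<le> ?s l" for l using U1 by (simp add: slab_share_def)
  \<comment> \<open>Maximality is imposed for each \<open>k\<close> separately; cubes for different
    \<open>k\<close> may overlap.\<close>
  define M where "M = {(k, d). (k, d) \<in> J \<and> (\<forall>e. (k, e) \<in> J \<longrightarrow> dyadic d \<subseteq> dyadic e \<longrightarrow> fst e \<le> fst d)}"
  have MJ: "M \<subseteq> J" by (auto simp: M_def)
  have M_max: "fst e \<le> fst d" if "(k, d) \<in> M" "(k, e) \<in> J" "dyadic d \<subseteq> dyadic e" for k d e
    using that unfolding M_def mem_Collect_eq case_prod_conv by blast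
  from MJ have finM: "finite M" using \<open>finite J\<close> finite_subset by blast
  have maximal_above: "\<exists>e. (k, e) \<in> M \<and> triple d \<subseteq> triple e" if kd: "(k, d) \<in> J" for k d
  proof -
    define E where "E = {e. (k, e) \<in> J \<and> dyadic d \<subseteq> dyadic e \<and> triple d \<subseteq> triple e}"
    have "E \<subseteq> snd ` J" by (force simp: E_def)
    then have E: "finite E" "d \<in> E" using \<open>finite J\<close> kd finite_subset by (blast, simp add: E_def)
    have "Max (fst ` E) \<in> fst ` E" using E by (intro Max_in) auto
    then obtain P where "P \<in> E" "fst P = Max (fst ` E)" by (metis imageE)
    then have P: "P \<in> E" "\<And>e. e \<in> E \<Longrightarrow> fst e \<le> fst P" using E by simp_all
    have "fst e \<le> fst P" if e: "(k, e) \<in> J" "dyadic P \<subseteq> dyadic e" for e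
    proof (rule ccontr)
      assume "\<not> ?thesis"
      moreover obtain x where "x \<in> dyadic P"
        using emeasure_dyadic_pos[of P] by (metis all_not_in_conv emeasure_empty less_irrefl)
      ultimately have "triple P \<subseteq> triple e" using triple_nested[of P e x] e by auto
      then have "e \<in> E" using P(1) e unfolding E_def by auto
      then show False using P(2) \<open>\<not> fst e \<le> fst P\<close> by blast
    qed
    then have "(k, P) \<in> M" using P(1) unfolding M_def E_def mem_Collect_eq case_prod_conv by blast
    then show ?thesis using P(1) unfolding E_def by blast
  qed
  have disj: "d = e" if de: "(k, d) \<in> M" "(k, e) \<in> M" "dyadic d \<inter> dyadic e \<noteq> {}" for k d e
  proof -
    obtain x where x: "x \<in> dyadic d" "x \<in> dyadic e" using de(3) by blast
    have "fst d = fst e"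
    proof (cases "fst d \<le> fst e")
      case True
      then show ?thesis using dyadic_nested[OF True x] M_max[of k d e] de(1,2) MJ by fastforce
    next
      case False
      then show ?thesis using dyadic_nested[OF _ x(2,1)] M_max[of k e d] de(1,2) MJ by fastforce
    qed
    then show ?thesis using dyadic_eqI x by blast
  qed
  define lev where "lev = (\<lambda>(k, d). level v d - k)"
  have per_level: "(\<Sum>(k, d)\<in>{p\<in>M. lev p = l}. ennreal (2 powi k) * emeasure (weighted u) (triple d)) \<le> ?I" for l
  proof -
    let ?M = "{p\<in>M. lev p = l}"
    \<comment> \<open>For fixed \<open>l\<close> the cube determines
      \<open>k = level v d - l\<close>, so pairs may be indexed by cubes; equal levels of
      \<open>v\<close> then mean equal \<open>k\<close>, where disjointness is known.\<close>
    have inj: "inj_on snd ?M" by (auto simp: inj_on_def lev_def)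
    have "(\<Sum>(k, d)\<in>?M. ennreal (2 powi k) * emeasure (weighted u) (triple d))
        = (\<Sum>d\<in>snd ` ?M. ennreal (2 powi (level v d - l)) * emeasure (weighted u) (triple d))"
      by (subst sum.reindex[OF inj]) (auto simp: lev_def intro!: sum.cong)
    also have "\<dots> \<le> ?I"
    proof (rule sum_level_class[OF u wv h])
      show "finite (snd ` ?M)" using finM by simp
      have mem: "(level v d - l, d) \<in> M" if "d \<in> snd ` ?M" for d
        using that by (auto simp: lev_def)
      show "d = e" if "d \<in> snd ` ?M" "e \<in> snd ` ?M" "level v d = level v e" "dyadic d \<inter> dyadic e \<noteq> {}" for d e
        using disj[of "level v d - l" d e] mem[OF that(1)] mem[OF that(2)] that(3,4) by simp
      show "ennreal (2 powi (level v d - l)) * emeasure lebesgue (dyadic d) \<le> (\<integral>\<^sup>+x\<in>dyadic d. h x \<partial>lebesgue)"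
        if "d \<in> snd ` ?M" for d
        using avg mem[OF that] MJ by blast
    qed
    finally show ?thesis .
  qed
  have meas: "slab v k \<inter> triple d \<in> sets lebesgue" for k d
    by (intro sets.Int slab_measurable weight_measurable wv triple_measurable)
  have "emeasure (weighted (\<lambda>x. u x * v x)) (\<Union>(k, d)\<in>J. slab v k \<inter> triple d)
      \<le> emeasure (weighted (\<lambda>x. u x * v x)) (\<Union>p\<in>M. slab v (fst p) \<inter> triple (snd p))"
  proof (rule emeasure_mono)
    show "(\<Union>(k, d)\<in>J. slab v k \<inter> triple d) \<subseteq> (\<Union>p\<in>M. slab v (fst p) \<inter> triple (snd p))"
    proof safe
      fix k d x assume "(k, d) \<in> J" "x \<in> slab v k" "x \<in> triple d"
      then show "x \<in> (\<Union>p\<in>M. slab v (fst p) \<inter> triple (snd p))"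
        using maximal_above[of k d] by force
    qed
    show "(\<Union>p\<in>M. slab v (fst p) \<inter> triple (snd p)) \<in> sets (weighted (\<lambda>x. u x * v x))"
      using finM meas by (auto intro!: sets.finite_UN)
  qed
  also have "\<dots> \<le> (\<Sum>p\<in>M. emeasure (weighted (\<lambda>x. u x * v x)) (slab v (fst p) \<inter> triple (snd p)))"
    using finM meas by (intro emeasure_subadditive_finite) auto
  also have "\<dots> \<le> (\<Sum>p\<in>M. 2 * (ennreal (?s (lev p)) * (ennreal (2 powi fst p) * emeasure (weighted u) (triple (snd p)))))"
  proof (rule sum_mono)
    fix p
    have "emeasure (weighted (\<lambda>x. u x * v x)) (slab v (fst p) \<inter> triple (snd p))
      \<le> 2 * (ennreal (2 powi fst p) * emeasure (weighted u) (slab v (fst p) \<inter> triple (snd p)))"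
      by (rule weighted_slab_le[OF wu wv])
    also have "\<dots> \<le> 2 * (ennreal (2 powi fst p) * (ennreal (?s (level v (snd p) - fst p)) * emeasure (weighted u) (triple (snd p))))"
      by (intro mult_left_mono slab_triple_le[OF u v U A]) auto
    finally show "emeasure (weighted (\<lambda>x. u x * v x)) (slab v (fst p) \<inter> triple (snd p))
      \<le> 2 * (ennreal (?s (lev p)) * (ennreal (2 powi fst p) * emeasure (weighted u) (triple (snd p))))"
      by (simp only: lev_def case_prod_beta mult.left_commute[of "ennreal (2 powi fst p)"])
  qed
  also have "\<dots> = (\<Sum>l\<in>lev ` M. \<Sum>p\<in>{p\<in>M. lev p = l}. 2 * (ennreal (?s (lev p)) * (ennreal (2 powi fst p) * emeasure (weighted u) (triple (snd p)))))"
    by (rule sum.image_gen[OF finM])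
  also have "\<dots> = (\<Sum>l\<in>lev ` M. 2 * ennreal (?s l) * (\<Sum>(k, d)\<in>{p\<in>M. lev p = l}. ennreal (2 powi k) * emeasure (weighted u) (triple d)))"
    by (intro sum.cong refl) (simp add: sum_distrib_left case_prod_beta mult.assoc)
  also have "\<dots> \<le> (\<Sum>l\<in>lev ` M. 2 * ennreal (?s l) * ?I)"
    by (intro sum_mono mult_left_mono per_level) auto
  also have "\<dots> = 2 * ennreal (\<Sum>l\<in>lev ` M. ?s l) * ?I"
    unfolding sum_distrib_left[symmetric] sum_distrib_right[symmetric] sum_ennreal[OF s0] ..
  also have "\<dots> \<le> 2 * ennreal ((2 * real CARD('n) + 3 + log 2 A) + (real CARD('n) + 1) * (2 * U)) * ?I"
    using finM by (intro mult_right_mono mult_left_mono ennreal_leI sum_slab_share_le U1 A1) auto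
  finally show ?thesis .
qed

section \<open>The weak type bound\<close>

lemma mult_less_of_less_divide_ennreal:
  fixes a b c :: ennreal
  assumes "a < b / c" "0 < c"
  shows "a * c < b"
  using divide_le_posI_ennreal[OF assms(2), of b a] assms(1) by (auto simp: mult.commute not_le[symmetric])

text \<open>\<open>cube_cover_dyadic\<close> with \<open>c = t * v x\<close> gives the dyadic cube,
  and \<open>k\<close> is the slab index of \<open>x\<close>. The factor \<open>4^n / t\<close>
  normalises the integrand so that its average is compared with \<open>2^k\<close> alone.\<close>

lemma superlevel_subset_slabs:
  fixes v f :: "real ^ 'n \<Rightarrow> real"
  assumes [measurable]: "(\<lambda>y. f y * v y) \<in> borel_measurable lebesgue"
    and t: "0 < t" and v: "0 < v x"
    and x: "ennreal t < maximal (\<lambda>y. f y * v y) x / ennreal (v x)"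
  shows "\<exists>k d. x \<in> slab v k \<inter> triple d \<and> ennreal (2 powi k) * emeasure lebesgue (dyadic d)
    \<le> (\<integral>\<^sup>+y\<in>dyadic d. ennreal (4 ^ CARD('n) / t * \<bar>f y * v y\<bar>) \<partial>lebesgue)"
proof -
  let ?g = "\<lambda>y. ennreal \<bar>f y * v y\<bar>"
  have "ennreal (t * v x) < maximal (\<lambda>y. f y * v y) x"
    using mult_less_of_less_divide_ennreal[OF x] t v by (simp add: ennreal_mult)
  then obtain a l where l: "0 < l" and xC: "x \<in> cbox a (a + (\<chi> i. l))"
    and "ennreal (t * v x) < (\<integral>\<^sup>+y\<in>cbox a (a + (\<chi> i. l)). ?g y \<partial>lebesgue) / emeasure lebesgue (cbox a (a + (\<chi> i. l)))"
    unfolding maximal_def less_SUP_iff cubes_def by blast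
  then have "ennreal (t * v x) < (\<integral>\<^sup>+y\<in>cbox a (a + (\<chi> i. l)). ?g y \<partial>lebesgue) / ennreal (l ^ CARD('n))"
    using emeasure_cube(1)[of l a] by simp
  then have "ennreal (t * v x) * ennreal (l ^ CARD('n)) < (\<integral>\<^sup>+y\<in>cbox a (a + (\<chi> i. l)). ?g y \<partial>lebesgue)"
    using l by (intro mult_less_of_less_divide_ennreal) auto
  from cube_cover_dyadic[OF l xC _ this] obtain d where d: "x \<in> triple d"
    "ennreal (t * v x) * emeasure lebesgue (dyadic d) < ennreal (4 ^ CARD('n)) * (\<integral>\<^sup>+y\<in>dyadic d. ?g y \<partial>lebesgue)"
    by auto
  define k where "k = \<lfloor>log 2 (v x)\<rfloor>"
  have k: "2 powi k \<le> v x" "v x < 2 powi (k + 1)"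
    using floor_log_powi[OF v] by (simp_all add: k_def)
  have "ennreal (2 powi k) * emeasure lebesgue (dyadic d) \<le> ennreal (v x) * emeasure lebesgue (dyadic d)"
    using k(1) by (intro mult_right_mono ennreal_leI) auto
  also have "\<dots> = ennreal (1 / t) * (ennreal (t * v x) * emeasure lebesgue (dyadic d))"
    using t v by (simp add: mult.assoc[symmetric] flip: ennreal_mult del: emeasure_completion)
  also have "\<dots> \<le> ennreal (1 / t) * (ennreal (4 ^ CARD('n)) * (\<integral>\<^sup>+y\<in>dyadic d. ?g y \<partial>lebesgue))"
    using d(2) by (intro mult_left_mono) auto
  also have "\<dots> = ennreal (4 ^ CARD('n) / t) * (\<integral>\<^sup>+y\<in>dyadic d. ?g y \<partial>lebesgue)"
    using t by (simp add: mult.assoc[symmetric] flip: ennreal_mult)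
  also have "\<dots> = (\<integral>\<^sup>+y. ennreal (4 ^ CARD('n) / t) * (?g y * indicator (dyadic d) y) \<partial>lebesgue)"
    by (intro nn_integral_cmult[symmetric]) measurable
  also have "\<dots> = (\<integral>\<^sup>+y\<in>dyadic d. ennreal (4 ^ CARD('n) / t * \<bar>f y * v y\<bar>) \<partial>lebesgue)"
    by (intro nn_integral_cong) (simp only: ennreal_mult''[OF abs_ge_zero] mult.assoc)
  finally have "ennreal (2 powi k) * emeasure lebesgue (dyadic d)
    \<le> (\<integral>\<^sup>+y\<in>dyadic d. ennreal (4 ^ CARD('n) / t * \<bar>f y * v y\<bar>) \<partial>lebesgue)" .
  moreover have "x \<in> slab v k \<inter> triple d" using k d(1) by (simp add: slab_def)
  ultimately show ?thesis by (intro exI conjI)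
qed

text \<open>The admissible pairs are countable, so finite subfamilies suffice. The integral of
  \<open>h u\<close> is \<open>4^n / t\<close> times the norm of \<open>f\<close>, and its
  \<open>1 / t\<close> cancels the \<open>t\<close> of the weak norm.\<close>

lemma superlevel_measure_le:
  fixes u v f :: "real ^ 'n \<Rightarrow> real"
  assumes u: "A1_weight u" and v: "A1_weight v"
    and U: "A1_const u = ennreal U" and A: "A1_const v = ennreal A"
    and f [measurable]: "f \<in> borel_measurable lebesgue" and t: "0 < t"
  shows "ennreal t * emeasure (weighted (\<lambda>x. u x * v x))
      {x. ennreal t < maximal (\<lambda>y. f y * v y) x / ennreal (v x)}
    \<le> 2 * ennreal ((2 * real CARD('n) + 3 + log 2 A) + (real CARD('n) + 1) * (2 * U)) *
      (ennreal (16 * 9 ^ CARD('n)) * A1_const u * Ainf_const v *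
        (ennreal (4 ^ CARD('n)) * L1_norm (weighted (\<lambda>x. u x * v x)) f))"
proof -
  note wu = A1_weightD[OF u] and wv = A1_weightD[OF v]
  note [measurable] = weight_measurable[OF wu] weight_measurable[OF wv]
  let ?\<mu> = "weighted (\<lambda>x. u x * v x)"
  define h where "h y = ennreal (4 ^ CARD('n) / t * \<bar>f y * v y\<bar>)" for y
  have h [measurable]: "h \<in> borel_measurable lebesgue" unfolding h_def by measurable
  define J where "J = {(k :: int, d). ennreal (2 powi k) * emeasure lebesgue (dyadic d) \<le> (\<integral>\<^sup>+x\<in>dyadic d. h x \<partial>lebesgue)}"
  let ?X = "\<lambda>(k, d). slab v k \<inter> triple d"
  let ?B = "2 * ennreal ((2 * real CARD('n) + 3 + log 2 A) + (real CARD('n) + 1) * (2 * U))"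
  have X: "?X p \<in> sets ?\<mu>" for p
    by (cases p) (auto intro!: sets.Int slab_measurable)
  have UX: "(\<Union>p\<in>J. ?X p) \<in> sets ?\<mu>" using X by (intro sets.countable_UN'') auto
  have "emeasure ?\<mu> {x. ennreal t < maximal (\<lambda>y. f y * v y) x / ennreal (v x)} \<le> emeasure ?\<mu> (\<Union>p\<in>J. ?X p)"
  \<comment> \<open>The inclusion is claimed only almost everywhere because points with
    \<open>v x = 0\<close> lie in no slab.\<close>
  proof (rule emeasure_mono_AE[OF _ UX])
    have "AE x in lebesgue. ennreal t < maximal (\<lambda>y. f y * v y) x / ennreal (v x) \<longrightarrow> x \<in> (\<Union>p\<in>J. ?X p)"
      using weight_AE_pos[OF wv]
    proof eventually_elim
      case (elim x)
      show ?case
      proof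
        assume "ennreal t < maximal (\<lambda>y. f y * v y) x / ennreal (v x)"
        from superlevel_subset_slabs[OF _ t elim this] obtain k d where
          "x \<in> slab v k \<inter> triple d" "(k, d) \<in> J"
          unfolding J_def h_def by auto
        then show "x \<in> (\<Union>p\<in>J. ?X p)" by blast
      qed
    qed
    then show "AE x in ?\<mu>. x \<in> {x. ennreal t < maximal (\<lambda>y. f y * v y) x / ennreal (v x)} \<longrightarrow> x \<in> (\<Union>p\<in>J. ?X p)"
      unfolding weighted_def by (subst AE_density) (auto elim: eventually_mono)
  qed
  also have "\<dots> \<le> ?B * (ennreal (16 * 9 ^ CARD('n)) * A1_const u * Ainf_const v * (\<integral>\<^sup>+x. h x * ennreal (u x) \<partial>lebesgue))"
  proof (rule emeasure_UN_le_finite[OF _ X])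
    fix F assume F: "finite F" "F \<subseteq> J"
    show "emeasure ?\<mu> (\<Union>p\<in>F. ?X p) \<le> ?B * (ennreal (16 * 9 ^ CARD('n)) * A1_const u * Ainf_const v * (\<integral>\<^sup>+x. h x * ennreal (u x) \<partial>lebesgue))"
      using F(2) by (intro weighted_slab_Union_le[OF u v U A h F(1)]) (auto simp: J_def simp del: emeasure_completion)
  qed simp
  also have "(\<integral>\<^sup>+x. h x * ennreal (u x) \<partial>lebesgue) = ennreal (4 ^ CARD('n) / t) * L1_norm ?\<mu> f"
  proof -
    have "L1_norm ?\<mu> f = (\<integral>\<^sup>+x. ennreal (u x * v x) * ennreal \<bar>f x\<bar> \<partial>lebesgue)"
      unfolding L1_norm_def weighted_def by (intro nn_integral_density) measurable
    also have "ennreal (4 ^ CARD('n) / t) * \<dots> = (\<integral>\<^sup>+x. ennreal (4 ^ CARD('n) / t) * (ennreal (u x * v x) * ennreal \<bar>f x\<bar>) \<partial>lebesgue)"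
      by (intro nn_integral_cmult[symmetric]) measurable
    also have "\<dots> = (\<integral>\<^sup>+x. h x * ennreal (u x) \<partial>lebesgue)"
      using t weight_nonneg[OF wu] weight_nonneg[OF wv]
      by (intro nn_integral_cong) (simp add: h_def abs_mult mult_ac flip: ennreal_mult)
    finally show ?thesis ..
  qed
  finally have "ennreal t * emeasure ?\<mu> {x. ennreal t < maximal (\<lambda>y. f y * v y) x / ennreal (v x)}
    \<le> ennreal t * (?B * (ennreal (16 * 9 ^ CARD('n)) * A1_const u * Ainf_const v * (ennreal (4 ^ CARD('n) / t) * L1_norm ?\<mu> f)))"
    by (intro mult_left_mono) auto
  also have "\<dots> = ?B * (ennreal (16 * 9 ^ CARD('n)) * A1_const u * Ainf_const v * ((ennreal t * ennreal (4 ^ CARD('n) / t)) * L1_norm ?\<mu> f))"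
    by (simp only: mult_ac)
  also have "ennreal t * ennreal (4 ^ CARD('n) / t) = ennreal (4 ^ CARD('n))"
    using t by (simp flip: ennreal_mult)
  finally show ?thesis .
qed

theorem theorem4p4:
  shows "\<exists>c::real. 0 < c \<and>
    (\<forall>(u :: real ^ 'n \<Rightarrow> real) v f.
       A1_weight u \<longrightarrow> A1_weight v \<longrightarrow> integrable (weighted (\<lambda>x. u x * v x)) f \<longrightarrow>
       weak_L1_norm (weighted (\<lambda>x. u x * v x))
           (\<lambda>x. maximal (\<lambda>y. f y * v y) x / ennreal (v x))
         \<le> ennreal c * A1_const u * Ainf_const v *
             (A1_const u * Ainf_const v + ennreal (ln (enn2real (A1_const v)))) *
             L1_norm (weighted (\<lambda>x. u x * v x)) f)"
proof (intro exI conjI allI impI)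
  let ?n = "real CARD('n)"
  \<comment> \<open>\<open>32 = 2 * 16\<close>, \<open>9^n\<close> and \<open>4^n\<close> come from
    \<open>superlevel_measure_le\<close>; \<open>4 n + 5 = (2 n + 3) + 2 (n + 1)\<close> collects
    the coefficients once 1 is bounded by \<open>U\<close>.\<close>
  let ?c = "32 * (4 * ?n + 5) * 9 ^ CARD('n) * 4 ^ CARD('n)"
  show "0 < ?c" by simp
  fix u v f :: "real ^ 'n \<Rightarrow> real"
  assume u: "A1_weight u" and v: "A1_weight v" and f: "integrable (weighted (\<lambda>x. u x * v x)) f"
  let ?\<mu> = "weighted (\<lambda>x. u x * v x)"
  let ?V = "Ainf_const v"
  have fm: "f \<in> borel_measurable lebesgue"
    using borel_measurable_integrable[OF f] by (simp add: measurable_cong_sets[OF sets_weighted refl])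
  obtain U where U: "A1_const u = ennreal U" "0 \<le> U"
    using u by (cases "A1_const u") (auto simp: A1_weight_def)
  obtain A where A: "A1_const v = ennreal A" "0 \<le> A"
    using v by (cases "A1_const v") (auto simp: A1_weight_def)
  have U1: "1 \<le> U" and A1: "1 \<le> A"
    using A1_const_ge_1[OF u] A1_const_ge_1[OF v] U A by (simp_all add: ennreal_ge_1)
  have bound: "ennreal ((2 * ?n + 3 + log 2 A) + (?n + 1) * (2 * U)) \<le> ennreal (4 * ?n + 5) * (A1_const u * ?V + ennreal (ln A))"
  proof -
    \<comment> \<open>This converts the base-2 logarithm into the natural one at the cost of a
      factor 2.\<close>
    have "1 \<le> 2 * ln (2::real)" using ln2_ge_two_thirds by simp
    then have "1 * ln A \<le> 2 * ln 2 * ln A" using A1 by (intro mult_right_mono) auto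
    then have "log 2 A \<le> 2 * ln A" by (simp add: log_def field_simps)
    also have "\<dots> \<le> (4 * ?n + 5) * ln A" using A1 by (intro mult_right_mono) auto
    finally have "log 2 A \<le> (4 * ?n + 5) * ln A" .
    moreover have "(2 * ?n + 3) * 1 \<le> (2 * ?n + 3) * U" using U1 by (intro mult_left_mono) auto
    ultimately have "(2 * ?n + 3 + log 2 A) + (?n + 1) * (2 * U) \<le> (4 * ?n + 5) * (U + ln A)"
      by (simp add: algebra_simps)
    then have "ennreal ((2 * ?n + 3 + log 2 A) + (?n + 1) * (2 * U)) \<le> ennreal (4 * ?n + 5) * (ennreal U + ennreal (ln A))"
      using U1 A1 by (simp add: ennreal_leI flip: ennreal_mult ennreal_plus)
    \<comment> \<open>\<open>U\<close> is enlarged to its product with the Fujii--Wilson constant,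
      which is at least 1.\<close>
    also have "\<dots> \<le> ennreal (4 * ?n + 5) * (A1_const u * ?V + ennreal (ln A))"
      using mult_left_mono[OF Ainf_const_ge_1[OF A1_weightD[OF v]], of "ennreal U"]
      unfolding U(1) by (intro mult_left_mono add_mono) auto
    finally show ?thesis .
  qed
  show "weak_L1_norm ?\<mu> (\<lambda>x. maximal (\<lambda>y. f y * v y) x / ennreal (v x))
      \<le> ennreal ?c * A1_const u * ?V * (A1_const u * ?V + ennreal (ln (enn2real (A1_const v)))) * L1_norm ?\<mu> f"
    unfolding weak_L1_norm_def
  proof (rule SUP_least)
    fix t :: real assume "t \<in> {0<..}"
    then have "ennreal t * emeasure ?\<mu> {x \<in> space ?\<mu>. ennreal t < maximal (\<lambda>y. f y * v y) x / ennreal (v x)}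
      \<le> 2 * ennreal ((2 * ?n + 3 + log 2 A) + (?n + 1) * (2 * U)) *
        (ennreal (16 * 9 ^ CARD('n)) * A1_const u * ?V * (ennreal (4 ^ CARD('n)) * L1_norm ?\<mu> f))"
      using superlevel_measure_le[OF u v U(1) A(1) fm] by simp
    also have "\<dots> \<le> 2 * (ennreal (4 * ?n + 5) * (A1_const u * ?V + ennreal (ln A))) *
        (ennreal (16 * 9 ^ CARD('n)) * A1_const u * ?V * (ennreal (4 ^ CARD('n)) * L1_norm ?\<mu> f))"
      by (intro mult_right_mono mult_left_mono bound) auto
    also have "\<dots> = (2 * ennreal (4 * ?n + 5) * ennreal (16 * 9 ^ CARD('n)) * ennreal (4 ^ CARD('n))) *
        A1_const u * ?V * (A1_const u * ?V + ennreal (ln A)) * L1_norm ?\<mu> f"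
      by (simp only: mult_ac)
    also have "2 * ennreal (4 * ?n + 5) * ennreal (16 * 9 ^ CARD('n)) * ennreal (4 ^ CARD('n)) = ennreal ?c"
    proof -
      have "2 * ennreal (4 * ?n + 5) * ennreal (16 * 9 ^ CARD('n)) * ennreal (4 ^ CARD('n))
          = ennreal (2 * (4 * ?n + 5) * (16 * 9 ^ CARD('n)) * 4 ^ CARD('n))"
        by (simp only: ennreal_mult'' ennreal_numeral zero_le_power zero_le_numeral mult_nonneg_nonneg)
      also have "2 * (4 * ?n + 5) * (16 * 9 ^ CARD('n)) * 4 ^ CARD('n) = ?c" by simp
      finally show ?thesis .
    qed
    finally show "ennreal t * emeasure ?\<mu> {x \<in> space ?\<mu>. ennreal t < maximal (\<lambda>y. f y * v y) x / ennreal (v x)}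
      \<le> ennreal ?c * A1_const u * ?V * (A1_const u * ?V + ennreal (ln (enn2real (A1_const v)))) * L1_norm ?\<mu> f"
      using A by simp
  qed
qed

end
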